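(* Let $G$ be a topological group and let $X$ be a compact metric $G$-space. The following conditions are equivalent: (1) $(G,X)$ is a tame system. (2) The enveloping semigroup $E(X)$ is an admissible Rosenthal compactum. (3) The enveloping semigroup $E(X)$ is a Rosenthal compactum.
   Context: Compact means compact Hausdorff. A $G$-space $X$, also written $(G,X)$, is a topological space with a (jointly) continuous action of the topological group $G$. A (not necessarily continuous) function $f:X\to (Y,\mu)$ from a topological space to a uniform space is fragmented if for every nonempty $A\subset X$ and every entourage $\varepsilon\in\mu$ there is an open $O\subset X$ such that $O\cap A\neq\emptyset$ and $f(O\cap A)$ is $\varepsilon$-small. A compact space carries its unique compatible uniformity. The enveloping semigroup $E(X)$ of a compact $G$-space $X$ is the closure in $X^X$ (pointwise topology) of the set of translations $\{x\mapsto gx\}_{g\in G}$. A compact $G$-space $X$ is tame if every $p\in E(X)$ is a fragmented map $p:X\to X$. $\mathcal{B}_1(X)$ is the space of real valued Baire class 1 functions on $X$ (preimages of open sets are $F_\sigma$) with the topology of pointwise convergence. A compact space $K$ is a Rosenthal compactum if it is homeomorphic to a pointwise compact subset of $\mathcal{B}_1(Z)$ for some Polish space $Z$. A subset $F\subset C(Z)$, $Z$ compact, is a Rosenthal family for $Z$ if $F$ is bounded in the supremum norm and every function in its pointwise closure $\mathrm{cls}_p(F)$ in $\mathbb{R}^Z$ is fragmented. A compact space $K$ is an admissible Rosenthal compactum if there exist a compact metric space $Z$ and a Rosenthal family $F\subset C(Z)$ for $Z$ such that $K$ is (homeomorphic to) a subspace of $\mathrm{cls}_p(F)$. *)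

theory Defs
  imports "HOL-Analysis.Analysis" "HOL-Algebra.Group_Action"
begin

no_notation eq_closure_of (\<open>closure'_of\<index>\<close>)

section \<open>Topological groups and G-spaces\<close>

definition topological_group :: "('g, 'm) monoid_scheme \<Rightarrow> 'g topology \<Rightarrow> bool" where
  "topological_group G T \<longleftrightarrow>
     group G \<and> topspace T = carrier G \<and>
     continuous_map (prod_topology T T) T (\<lambda>(g, h). g \<otimes>\<^bsub>G\<^esub> h) \<and>
     continuous_map T T (\<lambda>g. inv\<^bsub>G\<^esub> g)"

text \<open>
  A library group action is a homomorphism into \<^const>\<open>BijGroup\<close>, so each translation
  \<open>\<phi> g\<close> is extensional, hence a point of the product space \<open>X\<^sup>X\<close> as formed by
  \<^const>\<open>product_topology\<close>.
\<close>

definition G_space ::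
  "('g, 'm) monoid_scheme \<Rightarrow> 'g topology \<Rightarrow> 'a topology \<Rightarrow> ('g \<Rightarrow> 'a \<Rightarrow> 'a) \<Rightarrow> bool" where
  "G_space G T X \<phi> \<longleftrightarrow>
     group_action G (topspace X) \<phi> \<and>
     continuous_map (prod_topology T X) X (\<lambda>(g, x). \<phi> g x)"

definition enveloping_semigroup ::
  "('g, 'm) monoid_scheme \<Rightarrow> 'a topology \<Rightarrow> ('g \<Rightarrow> 'a \<Rightarrow> 'a) \<Rightarrow> ('a \<Rightarrow> 'a) set" where
  "enveloping_semigroup G X \<phi> =
     product_topology (\<lambda>_. X) (topspace X) closure_of (\<phi> ` carrier G)"

definition enveloping_space ::
  "('g, 'm) monoid_scheme \<Rightarrow> 'a topology \<Rightarrow> ('g \<Rightarrow> 'a \<Rightarrow> 'a) \<Rightarrow> ('a \<Rightarrow> 'a) topology" where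
  "enveloping_space G X \<phi> =
     subtopology (product_topology (\<lambda>_. X) (topspace X)) (enveloping_semigroup G X \<phi>)"


section \<open>Uniformities and fragmented maps\<close>

text \<open>
  As in the library class \<^class>\<open>uniform_space\<close>, a uniformity is represented by the filter whose
  eventually true predicates are the entourages, here relativised to a carrier set.
\<close>

definition uniform_structure :: "'a set \<Rightarrow> ('a \<times> 'a) filter \<Rightarrow> bool" where
  "uniform_structure S \<mu> \<longleftrightarrow>
     eventually (\<lambda>p. p \<in> S \<times> S) \<mu> \<and>
     (\<forall>E. eventually E \<mu> \<longrightarrow>
        (\<forall>x\<in>S. E (x, x)) \<and>
        eventually (\<lambda>(x, y). E (y, x)) \<mu> \<and>
        (\<exists>D. eventually D \<mu> \<and> (\<forall>x y z. D (x, y) \<longrightarrow> D (y, z) \<longrightarrow> E (x, z))))"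

definition compatible_uniformity :: "'a topology \<Rightarrow> ('a \<times> 'a) filter \<Rightarrow> bool" where
  "compatible_uniformity X \<mu> \<longleftrightarrow>
     uniform_structure (topspace X) \<mu> \<and>
     (\<forall>U. openin X U \<longleftrightarrow>
        U \<subseteq> topspace X \<and> (\<forall>x\<in>U. eventually (\<lambda>(x', y). x' = x \<longrightarrow> y \<in> U) \<mu>))"

text \<open>
  The entourages are the neighbourhoods of the diagonal. That this is the unique compatible
  uniformity of a compact Hausdorff space is proved below as \<open>compatible_uniformity_iff\<close>.
\<close>

definition compact_uniformity :: "'a topology \<Rightarrow> ('a \<times> 'a) filter" where
  "compact_uniformity X =
     (INF U \<in> {U. openin (prod_topology X X) U \<and> Id_on (topspace X) \<subseteq> U}. principal U)"

definition fragmented :: "'a topology \<Rightarrow> ('b \<times> 'b) filter \<Rightarrow> ('a \<Rightarrow> 'b) \<Rightarrow> bool" where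
  "fragmented X \<mu> f \<longleftrightarrow>
     (\<forall>A E. A \<subseteq> topspace X \<and> A \<noteq> {} \<and> eventually E \<mu> \<longrightarrow>
        (\<exists>W. openin X W \<and> W \<inter> A \<noteq> {} \<and> (\<forall>x \<in> W \<inter> A. \<forall>y \<in> W \<inter> A. E (f x, f y))))"

definition tame ::
  "('g, 'm) monoid_scheme \<Rightarrow> 'a topology \<Rightarrow> ('g \<Rightarrow> 'a \<Rightarrow> 'a) \<Rightarrow> bool" where
  "tame G X \<phi> \<longleftrightarrow> (\<forall>p \<in> enveloping_semigroup G X \<phi>. fragmented X (compact_uniformity X) p)"

lemma eventually_compact_uniformity:
  "eventually P (compact_uniformity X) \<longleftrightarrow>
     (\<exists>U. openin (prod_topology X X) U \<and> Id_on (topspace X) \<subseteq> U \<and> (\<forall>p\<in>U. P p))"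
proof -
  let ?B = "{U. openin (prod_topology X X) U \<and> Id_on (topspace X) \<subseteq> U}"
  have "topspace X \<times> topspace X \<in> ?B"
    by (auto simp: openin_prod_Times_iff)
  then have "eventually P (INF U\<in>?B. principal U) \<longleftrightarrow> (\<exists>U\<in>?B. eventually P (principal U))"
  proof (intro eventually_INF_base)
    fix a b assume "a \<in> ?B" "b \<in> ?B"
    then show "\<exists>x\<in>?B. principal x \<le> inf (principal a) (principal b)"
      by (intro bexI[of _ "a \<inter> b"]) auto
  qed blast
  then show ?thesis
    by (auto simp: compact_uniformity_def eventually_principal)
qed

lemma compact_uniformityE:
  assumes "eventually P (compact_uniformity X)"
  obtains U where "openin (prod_topology X X) U" "Id_on (topspace X) \<subseteq> U" "\<forall>p\<in>U. P p"
  using assms unfolding eventually_compact_uniformity by (elim exE conjE)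

lemma compatible_compact_uniformity:
  assumes "compact_space X" "Hausdorff_space X"
  shows "compatible_uniformity X (compact_uniformity X)"
  unfolding compatible_uniformity_def uniform_structure_def
proof (intro conjI allI impI)
  have reg: "regular_space X"
    using assms by (rule compact_Hausdorff_imp_regular_space)
  show "eventually (\<lambda>p. p \<in> topspace X \<times> topspace X) (compact_uniformity X)"
    unfolding eventually_compact_uniformity
    by (rule exI[of _ "topspace X \<times> topspace X"]) (auto simp: openin_prod_Times_iff)
  fix E assume "eventually E (compact_uniformity X)"
  then obtain U where U: "openin (prod_topology X X) U" "Id_on (topspace X) \<subseteq> U" "\<forall>p\<in>U. E p"
    unfolding eventually_compact_uniformity by blast
  show "\<forall>x\<in>topspace X. E (x, x)"
    using U by blast
  show "eventually (\<lambda>(x, y). E (y, x)) (compact_uniformity X)"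
    unfolding eventually_compact_uniformity
  proof (intro exI conjI)
    show "openin (prod_topology X X) (U\<inverse>)"
      unfolding openin_prod_topology_alt
    proof (intro allI impI)
      fix x y assume "(x, y) \<in> U\<inverse>"
      then obtain V W where "openin X V" "openin X W" "y \<in> V" "x \<in> W" "V \<times> W \<subseteq> U"
        using U(1) unfolding openin_prod_topology_alt by (metis converse_iff)
      then show "\<exists>V W. openin X V \<and> openin X W \<and> x \<in> V \<and> y \<in> W \<and> V \<times> W \<subseteq> U\<inverse>"
        by blast
    qed
  qed (use U in auto)
  have "\<exists>A B. openin X A \<and> openin X B \<and> x \<in> B \<and> X closure_of B \<subseteq> A \<and> A \<times> A \<subseteq> U"
    if x: "x \<in> topspace X" for x
  proof -
    obtain V W where VW: "openin X V" "openin X W" "x \<in> V" "x \<in> W" "V \<times> W \<subseteq> U"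
      using U(1,2) x unfolding openin_prod_topology_alt by (metis Id_onI subsetD)
    then have "openin X (V \<inter> W)" "x \<in> V \<inter> W" by auto
    moreover have "neighbourhood_base_of (closedin X) X"
      using reg neighbourhood_base_of_closedin by blast
    ultimately obtain B C where BC: "openin X B" "closedin X C" "x \<in> B" "B \<subseteq> C" "C \<subseteq> V \<inter> W"
      unfolding neighbourhood_base_of by meson
    then have "X closure_of B \<subseteq> V \<inter> W"
      by (meson closure_of_minimal order_trans)
    then show ?thesis
      using VW BC \<open>openin X (V \<inter> W)\<close> by blast
  qed
  then obtain A B where AB: "\<And>x. x \<in> topspace X \<Longrightarrow> openin X (A x) \<and> openin X (B x) \<and> x \<in> B x
      \<and> X closure_of (B x) \<subseteq> A x \<and> A x \<times> A x \<subseteq> U"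
    by metis
  obtain F where F: "finite F" "F \<subseteq> B ` topspace X" "topspace X \<subseteq> \<Union>F"
    using assms(1) AB unfolding compact_space_alt
    by (smt (verit, best) Union_iff image_iff subset_iff)
  obtain I where I: "finite I" "I \<subseteq> topspace X" "F = B ` I"
    using F(1,2) by (meson finite_subset_image)
  define V where "V = (topspace X \<times> topspace X) \<inter>
    (\<Inter>i\<in>I. A i \<times> A i \<union> (topspace X - X closure_of (B i)) \<times> (topspace X - X closure_of (B i)))"
  have "openin (prod_topology X X)
      (A i \<times> A i \<union> (topspace X - X closure_of (B i)) \<times> (topspace X - X closure_of (B i)))"
    if "i \<in> I" for i
    using AB I(2) that by (intro openin_Un) (auto simp: openin_prod_Times_iff)
  then have "openin (prod_topology X X) V"
    unfolding V_def using I(1)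
    by (cases "I = {}") (auto simp: openin_prod_Times_iff intro!: openin_Int openin_INT2)
  moreover have "Id_on (topspace X) \<subseteq> V"
    using AB I(2) unfolding V_def by blast
  ultimately have "eventually (\<lambda>p. p \<in> V) (compact_uniformity X)"
    unfolding eventually_compact_uniformity by blast
  moreover have "E (x, z)" if xy: "(x, y) \<in> V" and yz: "(y, z) \<in> V" for x y z
  proof -
    obtain i where i: "i \<in> I" "y \<in> B i"
      using xy F(3) I(3) unfolding V_def by blast
    then have "y \<in> X closure_of (B i)"
      using AB I(2) by (meson closure_of_subset openin_subset subsetD)
    then have "x \<in> A i" "z \<in> A i"
      using xy yz i(1) unfolding V_def by blast+
    then show ?thesis
      using AB I(2) i(1) U(3) by blast
  qed
  ultimately show "\<exists>D. eventually D (compact_uniformity X) \<and>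
      (\<forall>x y z. D (x, y) \<longrightarrow> D (y, z) \<longrightarrow> E (x, z))"
    by (intro exI[of _ "\<lambda>p. p \<in> V"]) simp
next
  fix U
  show "openin X U \<longleftrightarrow> U \<subseteq> topspace X \<and>
    (\<forall>x\<in>U. eventually (\<lambda>(x', y). x' = x \<longrightarrow> y \<in> U) (compact_uniformity X))"
  proof (intro iffI conjI ballI)
    assume U: "openin X U"
    show "U \<subseteq> topspace X"
      using U by (rule openin_subset)
    fix x assume x: "x \<in> U"
    have "closedin X {x}"
      using assms(2) x \<open>U \<subseteq> topspace X\<close> by (simp add: closedin_Hausdorff_singleton subsetD)
    then have "openin X (topspace X - {x})" by blast
    then show "eventually (\<lambda>(x', y). x' = x \<longrightarrow> y \<in> U) (compact_uniformity X)"
      unfolding eventually_compact_uniformity using U x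
      by (intro exI[of _ "U \<times> U \<union> (topspace X - {x}) \<times> topspace X"] conjI openin_Un)
        (auto simp: openin_prod_Times_iff)
  next
    assume *: "U \<subseteq> topspace X \<and>
      (\<forall>x\<in>U. eventually (\<lambda>(x', y). x' = x \<longrightarrow> y \<in> U) (compact_uniformity X))"
    show "openin X U"
    proof (subst openin_subopen, intro ballI)
      fix x assume x: "x \<in> U"
      then have "x \<in> topspace X"
        using * by blast
      have ev: "eventually (\<lambda>(x', y). x' = x \<longrightarrow> y \<in> U) (compact_uniformity X)"
        using * x by simp
      obtain D where D: "openin (prod_topology X X) D" "Id_on (topspace X) \<subseteq> D"
          "\<forall>p\<in>D. case p of (x', y) \<Rightarrow> x' = x \<longrightarrow> y \<in> U"
        by (rule compact_uniformityE[OF ev])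
      have "(x, x) \<in> D"
        using D(2) \<open>x \<in> topspace X\<close> by blast
      then obtain V W where VW: "openin X V" "openin X W" "x \<in> V" "x \<in> W" "V \<times> W \<subseteq> D"
        using D(1) unfolding openin_prod_topology_alt by metis
      then have "W \<subseteq> U" using D(3) by blast
      then show "\<exists>W. openin X W \<and> x \<in> W \<and> W \<subseteq> U"
        using VW by blast
    qed
  qed
qed

lemma uniform_structure_carrier:
  "uniform_structure S \<mu> \<Longrightarrow> eventually (\<lambda>p. p \<in> S \<times> S) \<mu>"
  by (simp add: uniform_structure_def)

lemma uniform_structure_refl:
  assumes "uniform_structure S \<mu>" "eventually E \<mu>" "x \<in> S"
  shows "E (x, x)"
  using assms unfolding uniform_structure_def by (elim conjE allE[of _ E]) simp

lemma uniform_structure_sym: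
  assumes "uniform_structure S \<mu>" "eventually E \<mu>"
  shows "eventually (\<lambda>(x, y). E (y, x)) \<mu>"
  using assms by (simp add: uniform_structure_def)

lemma uniform_structure_trans:
  assumes "uniform_structure S \<mu>" "eventually E \<mu>"
  obtains D where "eventually D \<mu>" "\<And>x y z. D (x, y) \<Longrightarrow> D (y, z) \<Longrightarrow> E (x, z)"
proof -
  have "\<exists>D. eventually D \<mu> \<and> (\<forall>x y z. D (x, y) \<longrightarrow> D (y, z) \<longrightarrow> E (x, z))"
    using assms by (simp add: uniform_structure_def)
  then show thesis using that by (elim exE conjE) simp
qed

lemma compatible_uniformity_ball:
  assumes \<mu>: "compatible_uniformity X \<mu>" and E: "eventually E \<mu>" and x: "x \<in> topspace X"
  shows "\<exists>W. openin X W \<and> x \<in> W \<and> (\<forall>y\<in>W. E (x, y))"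
proof -
  have uni: "uniform_structure (topspace X) \<mu>"
    using \<mu> by (simp add: compatible_uniformity_def)
  define Q where "Q = (\<lambda>D y. eventually D \<mu> \<and> (\<forall>z. D (y, z) \<longrightarrow> E (x, z)))"
  define W where "W = {y \<in> topspace X. \<exists>D. Q D y}"
  have "eventually (\<lambda>(y', z). y' = y \<longrightarrow> z \<in> W) \<mu>" if y: "y \<in> W" for y
  proof -
    obtain D where "Q D y"
      using y W_def by blast
    then have D: "eventually D \<mu>" "\<And>z. D (y, z) \<Longrightarrow> E (x, z)"
      by (simp_all add: Q_def)
    obtain D' where D': "eventually D' \<mu>" "\<And>x y z. D' (x, y) \<Longrightarrow> D' (y, z) \<Longrightarrow> D (x, z)"
      using uniform_structure_trans[OF uni D(1)] by metis
    show ?thesis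
      using uniform_structure_carrier[OF uni] D'(1)
    proof eventually_elim
      case (elim p)
      obtain y' z where p: "p = (y', z)" by (cases p)
      have "z \<in> W" if "y' = y"
      proof -
        have "Q D' z"
          unfolding Q_def
        proof (intro conjI allI impI)
          fix w assume "D' (z, w)"
          with elim(2) p that show "E (x, w)"
            by (intro D(2) D'(2)[of y z]) simp_all
        qed (rule D'(1))
        moreover have "z \<in> topspace X"
          using elim(1) p by simp
        ultimately show ?thesis
          using W_def by blast
      qed
      then show ?case by (simp add: p)
    qed
  qed
  then have "openin X W"
    using \<mu> W_def by (simp add: compatible_uniformity_def)
  moreover have "Q E x"
    using E by (simp add: Q_def)
  then have "x \<in> W"
    using x W_def by blast
  moreover have "E (x, y)" if y: "y \<in> W" for y
  proof -
    obtain D where D: "Q D y" "y \<in> topspace X"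
      using y W_def by blast
    then have "D (y, y)"
      using uniform_structure_refl[OF uni, of D y] by (simp add: Q_def)
    then show ?thesis using D by (simp add: Q_def)
  qed
  ultimately show ?thesis by blast
qed

lemma uniform_structure_sym_refine:
  assumes "uniform_structure S \<mu>" "eventually E \<mu>"
  obtains D where "eventually D \<mu>" "\<And>x y. D (x, y) \<Longrightarrow> D (y, x)"
    "\<And>x y z. D (x, y) \<Longrightarrow> D (y, z) \<Longrightarrow> E (x, z)"
proof -
  obtain D where D: "eventually D \<mu>" "\<And>x y z. D (x, y) \<Longrightarrow> D (y, z) \<Longrightarrow> E (x, z)"
    using uniform_structure_trans[OF assms] by metis
  have "eventually (\<lambda>p. D p \<and> (case p of (x, y) \<Rightarrow> D (y, x))) \<mu>"
    by (rule eventually_conj[OF D(1) uniform_structure_sym[OF assms(1) D(1)]])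
  then show thesis
    by (rule that) (auto intro: D(2))
qed

theorem compatible_uniformity_iff:
  assumes X: "compact_space X" "Hausdorff_space X"
  shows "compatible_uniformity X \<mu> \<longleftrightarrow> \<mu> = compact_uniformity X"
proof
  assume \<mu>: "compatible_uniformity X \<mu>"
  then have uni: "uniform_structure (topspace X) \<mu>"
    unfolding compatible_uniformity_def by blast
  have "eventually P (compact_uniformity X)" if P: "eventually P \<mu>" for P
  proof -
    obtain D where D: "eventually D \<mu>" "\<And>x y. D (x, y) \<Longrightarrow> D (y, x)"
        "\<And>x y z. D (x, y) \<Longrightarrow> D (y, z) \<Longrightarrow> P (x, z)"
      using uniform_structure_sym_refine[OF uni P] by metis
    obtain W where W: "\<And>x. x \<in> topspace X \<Longrightarrow> openin X (W x) \<and> x \<in> W x \<and> (\<forall>y\<in>W x. D (x, y))"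
      using compatible_uniformity_ball[OF \<mu> D(1)] by metis
    show ?thesis
      unfolding eventually_compact_uniformity
    proof (intro exI conjI)
      show "openin (prod_topology X X) (\<Union>x\<in>topspace X. W x \<times> W x)"
        using W by (intro openin_Union) (auto simp: openin_prod_Times_iff)
      show "Id_on (topspace X) \<subseteq> (\<Union>x\<in>topspace X. W x \<times> W x)"
        using W by blast
      show "\<forall>p\<in>(\<Union>x\<in>topspace X. W x \<times> W x). P p"
      proof
        fix p assume "p \<in> (\<Union>x\<in>topspace X. W x \<times> W x)"
        then obtain x y z where p: "p = (y, z)" and x: "x \<in> topspace X" "y \<in> W x" "z \<in> W x"
          by blast
        have "D (x, y)" "D (x, z)"
          using W[OF x(1)] x(2,3) by simp_all
        then show "P p"
          unfolding p by (intro D(3)[of y x z] D(2)[of x y])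
      qed
    qed
  qed
  moreover have "eventually P \<mu>" if P: "eventually P (compact_uniformity X)" for P
  proof -
    obtain U where U: "openin (prod_topology X X) U" "Id_on (topspace X) \<subseteq> U" "\<forall>p\<in>U. P p"
      by (rule compact_uniformityE[OF P])
    have "\<exists>D B. eventually D \<mu> \<and> openin X B \<and> x \<in> B \<and>
        (\<forall>y\<in>B. \<forall>z. D (y, z) \<longrightarrow> (y, z) \<in> U)" if x: "x \<in> topspace X" for x
    proof -
      obtain V W where VW: "openin X V" "openin X W" "x \<in> V" "x \<in> W" "V \<times> W \<subseteq> U"
        using U(1,2) x unfolding openin_prod_topology_alt by (metis Id_onI subsetD)
      then have "eventually (\<lambda>(x', y). x' = x \<longrightarrow> y \<in> W) \<mu>"
        using \<mu> unfolding compatible_uniformity_def by blast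
      then obtain D where D: "eventually D \<mu>"
          "\<And>u v w. D (u, v) \<Longrightarrow> D (v, w) \<Longrightarrow> (case (u, w) of (x', y) \<Rightarrow> x' = x \<longrightarrow> y \<in> W)"
        using uniform_structure_trans[OF uni] by metis
      obtain B where B: "openin X B" "x \<in> B" "\<forall>y\<in>B. D (x, y)"
        using compatible_uniformity_ball[OF \<mu> D(1) x] by blast
      have "(y, z) \<in> U" if "y \<in> B \<inter> V" "D (y, z)" for y z
        using that B(3) D(2)[of x y z] VW(5) by auto
      then show ?thesis
        using D(1) B VW by (intro exI[of _ D] exI[of _ "B \<inter> V"]) (simp add: openin_Int)
    qed
    then have "\<forall>x\<in>topspace X. \<exists>D B. eventually D \<mu> \<and> openin X B \<and> x \<in> B \<and>
        (\<forall>y\<in>B. \<forall>z. D (y, z) \<longrightarrow> (y, z) \<in> U)"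
      by (rule ballI)
    then obtain D where "\<forall>x\<in>topspace X. \<exists>B. eventually (D x) \<mu> \<and> openin X B \<and> x \<in> B \<and>
        (\<forall>y\<in>B. \<forall>z. D x (y, z) \<longrightarrow> (y, z) \<in> U)"
      unfolding bchoice_iff[where Q = "\<lambda>x D. \<exists>B. _ x D B"] by (elim exE)
    then obtain B where DB': "\<forall>x\<in>topspace X. eventually (D x) \<mu> \<and> openin X (B x) \<and> x \<in> B x \<and>
        (\<forall>y\<in>B x. \<forall>z. D x (y, z) \<longrightarrow> (y, z) \<in> U)"
      unfolding bchoice_iff by (elim exE)
    note DB = bspec[OF DB']
    obtain F where F: "finite F" "F \<subseteq> B ` topspace X" "topspace X \<subseteq> \<Union>F"
      using X(1) DB unfolding compact_space_alt
      by (smt (verit, best) Union_iff image_iff subset_iff)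
    obtain I where I: "finite I" "I \<subseteq> topspace X" "F = B ` I"
      using F(1,2) by (meson finite_subset_image)
    have "eventually (\<lambda>p. \<forall>i\<in>I. D i p) \<mu>"
      using I(1,2) DB by (intro eventually_ball_finite) auto
    moreover have "eventually (\<lambda>p. p \<in> topspace X \<times> topspace X) \<mu>"
      using uni unfolding uniform_structure_def by blast
    ultimately show ?thesis
    proof eventually_elim
      case (elim p)
      then obtain y z where p: "p = (y, z)" "y \<in> topspace X" by blast
      then obtain i where "i \<in> I" "y \<in> B i"
        using F(3) I(3) by blast
      then have "D i (y, z)" "i \<in> topspace X"
        using I(2) elim(1) p(1) by auto
      then have "(y, z) \<in> U"
        using DB[of i] \<open>y \<in> B i\<close> by simp
      then show ?case
        unfolding p(1) by (rule bspec[OF U(3)])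
    qed
  qed
  ultimately show "\<mu> = compact_uniformity X"
    unfolding filter_eq_iff by (intro allI iffI)
qed (simp add: compatible_compact_uniformity X)


section \<open>Rosenthal compacta\<close>

text \<open>
  Real functions on \<open>Z\<close> are taken extensional on \<^term>\<open>topspace Z\<close>, so that the pointwise
  topology on them is \<^term>\<open>powertop_real (topspace Z)\<close>.
\<close>

definition Polish_space :: "'z topology \<Rightarrow> bool" where
  "Polish_space Z \<longleftrightarrow> completely_metrizable_space Z \<and> separable_space Z"

definition Baire_class_1 :: "'z topology \<Rightarrow> ('z \<Rightarrow> real) set" where
  "Baire_class_1 Z =
     {f \<in> extensional (topspace Z). \<forall>U. open U \<longrightarrow> fsigma_in Z {z \<in> topspace Z. f z \<in> U}}"

definition Rosenthal_compactum_on :: "'z topology \<Rightarrow> 'k topology \<Rightarrow> bool" where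
  "Rosenthal_compactum_on Z K \<longleftrightarrow>
     (\<exists>S \<subseteq> Baire_class_1 Z. compactin (powertop_real (topspace Z)) S \<and>
        K homeomorphic_space subtopology (powertop_real (topspace Z)) S)"

text \<open>
  A formula cannot quantify over types, so the witnessing space \<open>Z\<close> is placed on a subset of the
  type \<^typ>\<open>real\<close>. No generality is lost, since Polish spaces have at most the cardinality of the
  continuum: see \<open>Rosenthal_compactumI\<close> and \<open>admissible_Rosenthal_compactumI\<close> below, where \<open>Z\<close>
  lives on an arbitrary type.
\<close>

definition Rosenthal_compactum :: "'k topology \<Rightarrow> bool" where
  "Rosenthal_compactum K \<longleftrightarrow>
     compact_space K \<and> Hausdorff_space K \<and>
     (\<exists>Z :: real topology. Polish_space Z \<and> Rosenthal_compactum_on Z K)"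

definition Rosenthal_family :: "'z topology \<Rightarrow> ('z \<Rightarrow> real) set \<Rightarrow> bool" where
  "Rosenthal_family Z F \<longleftrightarrow>
     F \<subseteq> {f \<in> extensional (topspace Z). continuous_map Z euclideanreal f} \<and>
     (\<exists>B. \<forall>f\<in>F. \<forall>z\<in>topspace Z. \<bar>f z\<bar> \<le> B) \<and>
     (\<forall>f \<in> powertop_real (topspace Z) closure_of F. fragmented Z uniformity f)"

definition admissible_Rosenthal_compactum_on :: "'z topology \<Rightarrow> 'k topology \<Rightarrow> bool" where
  "admissible_Rosenthal_compactum_on Z K \<longleftrightarrow>
     (\<exists>F. Rosenthal_family Z F \<and>
        (\<exists>S \<subseteq> powertop_real (topspace Z) closure_of F.
           K homeomorphic_space subtopology (powertop_real (topspace Z)) S))"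

definition admissible_Rosenthal_compactum :: "'k topology \<Rightarrow> bool" where
  "admissible_Rosenthal_compactum K \<longleftrightarrow>
     compact_space K \<and> Hausdorff_space K \<and>
     (\<exists>Z :: real topology. compact_space Z \<and> metrizable_space Z \<and>
        admissible_Rosenthal_compactum_on Z K)"


subsection \<open>Independence of the type of \<open>Z\<close>\<close>

lemma inj_real_if_separated:
  assumes "countable C"
    and sep: "\<And>x y. x \<in> S \<Longrightarrow> y \<in> S \<Longrightarrow> (\<And>c. c \<in> C \<Longrightarrow> P c x \<longleftrightarrow> P c y) \<Longrightarrow> x = y"
  shows "\<exists>e :: 'z \<Rightarrow> real. inj_on e S"
proof -
  define e0 where "e0 x = to_nat_on C ` {c \<in> C. P c x}" for x
  have "inj_on e0 S"
  proof (rule inj_onI)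
    fix x y assume xy: "x \<in> S" "y \<in> S" "e0 x = e0 y"
    have "{c \<in> C. P c x} = {c \<in> C. P c y}"
      using xy(3) inj_on_to_nat_on[OF assms(1)] unfolding e0_def
      by (subst (asm) inj_on_image_eq_iff) auto
    then show "x = y"
      using sep[OF xy(1,2)] by blast
  qed
  moreover obtain b :: "nat set \<Rightarrow> real" where "bij b"
    using nat_sets_eqpoll_reals unfolding eqpoll_def by blast
  ultimately have "inj_on (b \<circ> e0) S"
    by (meson bij_betw_imp_inj_on comp_inj_on inj_on_subset subset_UNIV)
  then show ?thesis by blast
qed

lemma separable_metrizable_inj_real:
  fixes Z :: "'z topology"
  assumes "metrizable_space Z" "separable_space Z"
  shows "\<exists>e :: 'z \<Rightarrow> real. inj_on e (topspace Z)"
proof -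
  obtain M d where "Metric_space M d" and Z: "Z = Metric_space.mtopology M d"
    using assms(1) unfolding metrizable_space_def by blast
  then interpret Metric_space M d by simp
  obtain C where C: "countable C" "C \<subseteq> M" "mtopology closure_of C = M"
    using assms(2) unfolding separable_space_def Z by auto
  have "\<exists>e :: 'z \<Rightarrow> real. inj_on e M"
  proof (rule inj_real_if_separated)
    show "countable (C \<times> (UNIV :: nat set))"
      using C(1) by simp
    fix x y
    assume xy: "x \<in> M" "y \<in> M"
      and eq: "\<And>c. c \<in> C \<times> UNIV \<Longrightarrow> d (fst c) x < 1 / Suc (snd c) \<longleftrightarrow> d (fst c) y < 1 / Suc (snd c)"
    show "x = y"
    proof (rule ccontr)
      assume "x \<noteq> y"
      then have "0 < d x y / 2"
        using xy by simp
      then obtain n where n: "1 / Suc n < d x y / 2"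
        using nat_approx_posE by blast
      have "x \<in> mtopology closure_of C"
        using C(3) xy by blast
      then obtain c where c: "c \<in> C" "c \<in> mball x (1 / Suc n)"
        unfolding metric_closure_of by (auto dest!: spec[of _ "1 / Suc n"])
      then have "d c x < 1 / Suc n"
        by (simp add: commute)
      moreover from this have "d c y < 1 / Suc n"
        using eq[of "(c, n)"] c(1) by simp
      moreover have "d x y \<le> d x c + d c y"
        using xy c C(2) by (intro triangle) auto
      ultimately show False
        using n commute[of x c] by linarith
    qed
  qed
  then show ?thesis
    by (simp add: Z)
qed

lemma compact_metrizable_imp_separable:
  assumes "compact_space Z" "metrizable_space Z"
  shows "separable_space Z"
proof -
  obtain M d where "Metric_space M d" and Z: "Z = Metric_space.mtopology M d"
    using assms(2) unfolding metrizable_space_def by blast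
  then interpret Metric_space M d by simp
  have "mtotally_bounded M"
    using assms(1) Z compact_space_eq_mcomplete_mtotally_bounded by blast
  then have "\<exists>K. finite K \<and> K \<subseteq> M \<and> M \<subseteq> (\<Union>x\<in>K. mball x (1 / Suc n))" for n
    unfolding mtotally_bounded_def by simp
  then obtain K where K: "\<And>n. finite (K n)" "\<And>n. K n \<subseteq> M" "\<And>n. M \<subseteq> (\<Union>x\<in>K n. mball x (1 / Suc n))"
    by metis
  have "x \<in> mtopology closure_of (\<Union>n. K n)" if x: "x \<in> M" for x
    unfolding metric_closure_of
  proof (intro CollectI conjI allI impI x)
    fix r :: real assume "0 < r"
    then obtain n where n: "1 / Suc n < r"
      using nat_approx_posE by blast
    obtain c where "c \<in> K n" "x \<in> mball c (1 / Suc n)"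
      using K(3)[of n] x by blast
    then have "c \<in> (\<Union>n. K n)" "c \<in> mball x r"
      using n commute[of x c] by auto
    then show "\<exists>y\<in>\<Union>n. K n. y \<in> mball x r"
      by blast
  qed
  then have "mtopology closure_of (\<Union>n. K n) = M"
    using closure_of_subset_topspace[of mtopology] by auto
  moreover have "countable (\<Union>n. K n)" "(\<Union>n. K n) \<subseteq> M"
    using K(1,2) by (auto intro: countable_finite)
  ultimately show ?thesis
    unfolding separable_space_def Z by auto
qed

lemma homeomorphic_real_topology:
  fixes Z :: "'z topology"
  assumes "metrizable_space Z" "separable_space Z"
  shows "\<exists>Z' :: real topology. Z homeomorphic_space Z'"
proof -
  obtain e :: "'z \<Rightarrow> real" where e: "inj_on e (topspace Z)"
    using separable_metrizable_inj_real[OF assms] by blast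
  define k where "k = inv_into (topspace Z) e"
  define Z' where "Z' = pullback_topology (e ` topspace Z) k Z"
  have ke: "k (e z) = z" if "z \<in> topspace Z" for z
    using e that by (simp add: k_def)
  then have top: "topspace Z' = e ` topspace Z"
    unfolding Z'_def topspace_pullback_topology by auto
  have "openin Z {z \<in> topspace Z. e z \<in> V}" if V: "openin Z' V" for V
  proof -
    obtain U where U: "openin Z U" "V = k -` U \<inter> e ` topspace Z"
      using V[unfolded Z'_def openin_pullback_topology] by (elim exE conjE)
    have "e z \<in> V \<longleftrightarrow> z \<in> U" if "z \<in> topspace Z" for z
      using U(2) ke[OF that] that by simp
    then have "{z \<in> topspace Z. e z \<in> V} = U"
      using openin_subset[OF U(1)] by blast
    then show ?thesis using U(1) by simp
  qed
  then have "continuous_map Z Z' e"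
    using top by (auto simp: continuous_map_def)
  moreover have "openin Z' {y \<in> topspace Z'. k y \<in> U}" if "openin Z U" for U
  proof -
    have "{y \<in> topspace Z'. k y \<in> U} = k -` U \<inter> e ` topspace Z"
      using top by auto
    then show ?thesis
      using that unfolding Z'_def openin_pullback_topology by (intro exI conjI)
  qed
  then have "continuous_map Z' Z k"
    using top ke by (auto simp: continuous_map_def)
  ultimately have "homeomorphic_maps Z Z' e k"
    using ke top by (auto simp: homeomorphic_maps_def)
  then show ?thesis
    unfolding homeomorphic_space_def by blast
qed

context
  fixes Z :: "'z topology" and Z' :: "'w topology" and h k
  assumes hk: "homeomorphic_maps Z Z' h k"
begin

lemma powertop_real_homeomorphic_maps:
  "homeomorphic_maps (powertop_real (topspace Z)) (powertop_real (topspace Z'))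
     (\<lambda>f. restrict (f \<circ> k) (topspace Z')) (\<lambda>f. restrict (f \<circ> h) (topspace Z))"
proof -
  have h: "h z \<in> topspace Z'" if "z \<in> topspace Z" for z
    using hk that unfolding homeomorphic_maps_def continuous_map_def by blast
  have k: "k z \<in> topspace Z" if "z \<in> topspace Z'" for z
    using hk that unfolding homeomorphic_maps_def continuous_map_def by blast
  have "restrict (restrict (f \<circ> k) (topspace Z') \<circ> h) (topspace Z) = f"
    if "f \<in> extensional (topspace Z)" for f :: "'z \<Rightarrow> real"
    using that h hk by (intro extensionalityI[of _ "topspace Z"]) (auto simp: homeomorphic_maps_def)
  moreover have "restrict (restrict (f \<circ> h) (topspace Z) \<circ> k) (topspace Z') = f"
    if "f \<in> extensional (topspace Z')" for f :: "'w \<Rightarrow> real"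
    using that k hk by (intro extensionalityI[of _ "topspace Z'"]) (auto simp: homeomorphic_maps_def)
  moreover have "continuous_map (powertop_real (topspace Z)) (powertop_real (topspace Z'))
      (\<lambda>f. restrict (f \<circ> k) (topspace Z'))"
    using k by (auto simp: continuous_map_componentwise intro: continuous_map_product_projection)
  moreover have "continuous_map (powertop_real (topspace Z')) (powertop_real (topspace Z))
      (\<lambda>f. restrict (f \<circ> h) (topspace Z))"
    using h by (auto simp: continuous_map_componentwise intro: continuous_map_product_projection)
  ultimately show ?thesis
    by (auto simp: homeomorphic_maps_def PiE_def)
qed

lemma Baire_class_1_transport:
  assumes "f \<in> Baire_class_1 Z"
  shows "restrict (f \<circ> k) (topspace Z') \<in> Baire_class_1 Z'"
proof -
  have k: "continuous_map Z' Z k"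
    using hk by (simp add: homeomorphic_maps_def)
  have "fsigma_in Z' {z \<in> topspace Z'. restrict (f \<circ> k) (topspace Z') z \<in> U}" if "open U" for U
  proof -
    have "fsigma_in Z {z \<in> topspace Z. f z \<in> U}"
      using assms that by (simp add: Baire_class_1_def)
    then obtain C where C: "\<And>n. closedin Z (C n)" "\<And>n. C n \<subseteq> C (Suc n)"
        "\<Union> (range C) = {z \<in> topspace Z. f z \<in> U}"
      unfolding fsigma_in_ascending by blast
    define C' where "C' n = {z \<in> topspace Z'. k z \<in> C n}" for n :: nat
    have "closedin Z' (C' n)" for n
      unfolding C'_def using k C(1) by (rule closedin_continuous_map_preimage)
    moreover have "C' n \<subseteq> C' (Suc n)" for n
      using C(2)[of n] by (auto simp: C'_def)
    moreover have "\<Union> (range C') = {z \<in> topspace Z'. k z \<in> \<Union> (range C)}"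
      by (auto simp: C'_def)
    then have "\<Union> (range C') = {z \<in> topspace Z'. restrict (f \<circ> k) (topspace Z') z \<in> U}"
      unfolding C(3) using k by (auto simp: continuous_map_def)
    ultimately show ?thesis
      unfolding fsigma_in_ascending by blast
  qed
  then show ?thesis
    unfolding Baire_class_1_def by simp
qed

lemma fragmented_transport:
  assumes "fragmented Z \<mu> f"
  shows "fragmented Z' \<mu> (restrict (f \<circ> k) (topspace Z'))"
  unfolding fragmented_def
proof (intro allI impI)
  have k: "continuous_map Z' Z k"
    using hk by (simp add: homeomorphic_maps_def)
  fix A E assume A: "A \<subseteq> topspace Z' \<and> A \<noteq> {} \<and> eventually E \<mu>"
  then have "k ` A \<subseteq> topspace Z \<and> k ` A \<noteq> {} \<and> eventually E \<mu>"
    using k by (auto simp: continuous_map_def)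
  with assms have "\<exists>W. openin Z W \<and> W \<inter> k ` A \<noteq> {} \<and>
      (\<forall>x\<in>W \<inter> k ` A. \<forall>y\<in>W \<inter> k ` A. E (f x, f y))"
    unfolding fragmented_def by (elim allE[of _ "k ` A"] allE[of _ E]) simp
  then obtain W where W: "openin Z W" "W \<inter> k ` A \<noteq> {}"
      "\<forall>x\<in>W \<inter> k ` A. \<forall>y\<in>W \<inter> k ` A. E (f x, f y)"
    by (elim exE conjE)
  show "\<exists>W. openin Z' W \<and> W \<inter> A \<noteq> {} \<and> (\<forall>x\<in>W \<inter> A. \<forall>y\<in>W \<inter> A.
      E (restrict (f \<circ> k) (topspace Z') x, restrict (f \<circ> k) (topspace Z') y))"
  proof (intro exI conjI)
    show "openin Z' {z \<in> topspace Z'. k z \<in> W}"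
      using k W(1) by (rule openin_continuous_map_preimage)
    show "{z \<in> topspace Z'. k z \<in> W} \<inter> A \<noteq> {}"
      using W(2) A by auto
    show "\<forall>x\<in>{z \<in> topspace Z'. k z \<in> W} \<inter> A. \<forall>y\<in>{z \<in> topspace Z'. k z \<in> W} \<inter> A.
        E (restrict (f \<circ> k) (topspace Z') x, restrict (f \<circ> k) (topspace Z') y)"
      using W(3) by simp
  qed
qed

lemma Rosenthal_compactum_on_transport:
  assumes "Rosenthal_compactum_on Z K"
  shows "Rosenthal_compactum_on Z' K"
proof -
  let ?P = "powertop_real (topspace Z)" and ?P' = "powertop_real (topspace Z')"
  let ?H = "\<lambda>f :: 'z \<Rightarrow> real. restrict (f \<circ> k) (topspace Z')"
  obtain S where S: "S \<subseteq> Baire_class_1 Z" "compactin ?P S" "K homeomorphic_space subtopology ?P S"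
    using assms unfolding Rosenthal_compactum_on_def by blast
  have H: "homeomorphic_map ?P ?P' ?H"
    using powertop_real_homeomorphic_maps by (rule homeomorphic_maps_imp_map)
  have sub: "S \<subseteq> topspace ?P"
    using S(2) by (rule compactin_subset_topspace)
  have sub': "?H ` S \<subseteq> topspace ?P'"
    using H sub homeomorphic_imp_surjective_map by blast
  have "homeomorphic_map (subtopology ?P S) (subtopology ?P' (?H ` S)) ?H"
    using H by (rule homeomorphic_map_subtopologies) (use sub sub' in \<open>simp only: Int_absorb1\<close>)
  then have "K homeomorphic_space subtopology ?P' (?H ` S)"
    using S(3) homeomorphic_map_imp_homeomorphic_space homeomorphic_space_trans by blast
  moreover have "compactin ?P' (?H ` S)"
    using S(2) homeomorphic_imp_continuous_map[OF H] by (rule image_compactin)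
  moreover have "?H ` S \<subseteq> Baire_class_1 Z'"
    using S(1) Baire_class_1_transport by blast
  ultimately show ?thesis
    unfolding Rosenthal_compactum_on_def by blast
qed

lemma admissible_Rosenthal_compactum_on_transport:
  assumes "admissible_Rosenthal_compactum_on Z K"
  shows "admissible_Rosenthal_compactum_on Z' K"
proof -
  let ?P = "powertop_real (topspace Z)" and ?P' = "powertop_real (topspace Z')"
  let ?H = "\<lambda>f :: 'z \<Rightarrow> real. restrict (f \<circ> k) (topspace Z')"
  obtain F S where F: "Rosenthal_family Z F"
    and S: "S \<subseteq> ?P closure_of F" "K homeomorphic_space subtopology ?P S"
    using assms unfolding admissible_Rosenthal_compactum_on_def by blast
  have H: "homeomorphic_map ?P ?P' ?H"
    using powertop_real_homeomorphic_maps by (rule homeomorphic_maps_imp_map)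
  have k: "continuous_map Z' Z k"
    using hk by (simp add: homeomorphic_maps_def)
  have "F \<subseteq> topspace ?P"
    using F by (auto simp: Rosenthal_family_def PiE_def)
  then have cl: "?P' closure_of (?H ` F) = ?H ` (?P closure_of F)"
    using H by (simp only: homeomorphic_map_closure_of)
  have sub: "S \<subseteq> topspace ?P"
    using S(1) closure_of_subset_topspace by (rule subset_trans)
  have sub': "?H ` S \<subseteq> topspace ?P'"
    using H sub homeomorphic_imp_surjective_map by blast
  have "homeomorphic_map (subtopology ?P S) (subtopology ?P' (?H ` S)) ?H"
    using H by (rule homeomorphic_map_subtopologies) (use sub sub' in \<open>simp only: Int_absorb1\<close>)
  then have "K homeomorphic_space subtopology ?P' (?H ` S)"
    using S(2) homeomorphic_map_imp_homeomorphic_space homeomorphic_space_trans by blast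
  moreover have "?H ` S \<subseteq> ?P' closure_of (?H ` F)"
    unfolding cl using S(1) by (rule image_mono)
  moreover have "Rosenthal_family Z' (?H ` F)"
    unfolding Rosenthal_family_def
  proof (intro conjI)
    have "continuous_map Z' euclideanreal (?H f)" if "f \<in> F" for f
    proof -
      have "continuous_map Z' euclideanreal (f \<circ> k)"
        using F that k by (intro continuous_map_compose[of _ Z]) (auto simp: Rosenthal_family_def)
      then show ?thesis
        by (rule continuous_map_eq) simp
    qed
    then show "?H ` F \<subseteq> {f \<in> extensional (topspace Z'). continuous_map Z' euclideanreal f}"
      by auto
    obtain B where B: "\<forall>f\<in>F. \<forall>z\<in>topspace Z. \<bar>f z\<bar> \<le> B"
      using F unfolding Rosenthal_family_def by blast
    have "\<forall>f\<in>?H ` F. \<forall>z\<in>topspace Z'. \<bar>f z\<bar> \<le> B"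
      using B k by (auto simp: continuous_map_def)
    then show "\<exists>B. \<forall>f\<in>?H ` F. \<forall>z\<in>topspace Z'. \<bar>f z\<bar> \<le> B"
      by (rule exI)
    have "fragmented Z uniformity f" if "f \<in> ?P closure_of F" for f
      using F that unfolding Rosenthal_family_def by blast
    then show "\<forall>f\<in>?P' closure_of (?H ` F). fragmented Z' uniformity f"
      unfolding cl using fragmented_transport by blast
  qed
  ultimately show ?thesis
    unfolding admissible_Rosenthal_compactum_on_def by blast
qed

end

theorem Rosenthal_compactumI:
  fixes Z :: "'z topology"
  assumes "compact_space K" "Hausdorff_space K" "Polish_space Z" "Rosenthal_compactum_on Z K"
  shows "Rosenthal_compactum K"
proof -
  have "metrizable_space Z" "separable_space Z"
    using assms(3) by (simp_all add: Polish_space_def completely_metrizable_imp_metrizable_space)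
  then obtain Z' :: "real topology" where Z': "Z homeomorphic_space Z'"
    using homeomorphic_real_topology by blast
  then have "Polish_space Z'"
    using assms(3) homeomorphic_completely_metrizable_space homeomorphic_separable_space
    unfolding Polish_space_def by blast
  moreover have "Rosenthal_compactum_on Z' K"
    using Z' assms(4) Rosenthal_compactum_on_transport unfolding homeomorphic_space_def by blast
  ultimately show ?thesis
    using assms(1,2) unfolding Rosenthal_compactum_def by blast
qed

theorem admissible_Rosenthal_compactumI:
  fixes Z :: "'z topology"
  assumes "compact_space K" "Hausdorff_space K" "compact_space Z" "metrizable_space Z"
    "admissible_Rosenthal_compactum_on Z K"
  shows "admissible_Rosenthal_compactum K"
proof -
  obtain Z' :: "real topology" where Z': "Z homeomorphic_space Z'"
    using homeomorphic_real_topology assms(3,4) compact_metrizable_imp_separable by blast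
  then have "compact_space Z'" "metrizable_space Z'"
    using assms(3,4) homeomorphic_compact_space homeomorphic_metrizable_space by blast+
  moreover have "admissible_Rosenthal_compactum_on Z' K"
    using Z' assms(5) admissible_Rosenthal_compactum_on_transport
    unfolding homeomorphic_space_def by blast
  ultimately show ?thesis
    using assms(1,2) unfolding admissible_Rosenthal_compactum_def by blast
qed

end

theory Submission
  imports Defs
begin

text \<open>
  Write \<open>E\<close> for the enveloping semigroup and \<open>d\<close> for a metric on the compact space \<open>X\<close>.

  Tame implies admissible: the map sending \<open>p\<close> to the function \<open>(x, y) \<mapsto> d y (p x)\<close> embeds \<open>E\<close>
  into the real functions on the compact metrizable space \<open>X \<times> X\<close>. It sends the translations to
  a bounded family of continuous functions, and by compactness of \<open>E\<close> the pointwise closure of this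
  family is the image of \<open>E\<close>. Such a function is fragmented as soon as \<open>p\<close> is, so the family is a
  Rosenthal family (\<open>closure_admissible_if_fragmented\<close>).

  Admissible implies Rosenthal: a fragmented real function on a separable metrizable space is of the
  first Baire class (\<open>fragmented_imp_Baire_class_1\<close>).

  Rosenthal implies tame: this is a counting argument. A Baire class 1 function on a Polish space is
  coded by countably many closed sets, so a Rosenthal compactum has at most as many points as there
  are sets of natural numbers (\<open>Rosenthal_compactum_inj_nat_set\<close>). If, on the other hand, some
  \<open>p \<in> E\<close> is not fragmented, then \<open>E\<close> maps onto the set of all families of sets of natural numbers
  (\<open>not_fragmented_imp_large_closure\<close>), which contradicts Cantor's theorem. This route avoids the
  theorem of Bourgain, Fremlin and Talagrand that Rosenthal compacta are Frechet-Urysohn spaces.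

  The map from \<open>E\<close> arises as follows. Failure of fragmentedness gives a set \<open>A\<close>, a point \<open>c\<close> and
  numbers \<open>a < b\<close> such that both \<open>{x. d c (p x) < a}\<close> and \<open>{x. b < d c (p x)}\<close> are dense in \<open>A\<close>.
  As \<open>p\<close> is a pointwise limit of translations, translations \<open>g\<^sub>0, g\<^sub>1, \<dots>\<close> can be picked one after
  the other so that the functions \<open>d c (g\<^sub>n x)\<close> realise every finite pattern of values below \<open>a\<close> and
  above \<open>b\<close>. Compactness of \<open>X\<close> gives, for each set \<open>s\<close> of natural numbers, a point \<open>x\<^sub>s\<close> at which
  the \<open>g\<^sub>n\<close> with \<open>n \<in> s\<close> give small values and all others large ones. Along an independent family of
  sets \<open>s\<close> that is as large as the power set of the natural numbers, the evaluations at the points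
  \<open>x\<^sub>s\<close> are independent functions on \<open>E\<close>, and compactness of \<open>E\<close> realises all infinite patterns.
\<close>

section \<open>Fragmented real functions are of the first Baire class\<close>

text \<open>
  The open sets that have such a countable cover are closed under countable unions, so among the
  unions of basic open sets there is a largest one, \<open>V\<close>. If \<open>V\<close> were not everything, fragmentedness
  on its complement \<open>A\<close> would give an open \<open>W\<close> that meets \<open>A\<close> in a set with small image; as
  \<open>W \<inter> A\<close> is locally closed, hence an F-sigma set, \<open>V\<close> could be enlarged.
\<close>

lemma fragmented_countable_fsigma_cover:
  fixes f :: "'z \<Rightarrow> 'b::metric_space"
  assumes Z: "second_countable Z" "metrizable_space Z"
    and f: "fragmented Z uniformity f" and e: "0 < e"
  shows "\<exists>\<C>. countable \<C> \<and> topspace Z \<subseteq> \<Union>\<C> \<and>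
           (\<forall>C\<in>\<C>. fsigma_in Z C \<and> (\<forall>x\<in>C. \<forall>y\<in>C. dist (f x) (f y) < e))"
proof -
  define small where "small C \<longleftrightarrow> fsigma_in Z C \<and> (\<forall>x\<in>C. \<forall>y\<in>C. dist (f x) (f y) < e)" for C
  define good where "good B \<longleftrightarrow> (\<exists>\<C>. countable \<C> \<and> B \<subseteq> \<Union>\<C> \<and> (\<forall>C\<in>\<C>. small C))" for B
  obtain \<B> where \<B>: "countable \<B>" "\<And>V. V \<in> \<B> \<Longrightarrow> openin Z V"
      "\<And>U x. openin Z U \<Longrightarrow> x \<in> U \<Longrightarrow> \<exists>V\<in>\<B>. x \<in> V \<and> V \<subseteq> U"
    using Z(1) unfolding second_countable_def by metis
  have good_Union: "good (\<Union>\<G>)" if \<G>: "countable \<G>" "\<And>B. B \<in> \<G> \<Longrightarrow> good B" for \<G>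
  proof -
    obtain \<C> where \<C>: "\<And>B. B \<in> \<G> \<Longrightarrow> countable (\<C> B) \<and> B \<subseteq> \<Union>(\<C> B) \<and> (\<forall>C\<in>\<C> B. small C)"
      using \<G>(2) unfolding good_def by metis
    have "countable (\<Union>B\<in>\<G>. \<C> B)"
      using \<G>(1) \<C> by (intro countable_UN) auto
    moreover have "\<Union>\<G> \<subseteq> \<Union>(\<Union>B\<in>\<G>. \<C> B)"
    proof
      fix z assume "z \<in> \<Union>\<G>"
      then obtain B where "B \<in> \<G>" "z \<in> B" by blast
      then show "z \<in> \<Union>(\<Union>B\<in>\<G>. \<C> B)"
        using \<C>[of B] by blast
    qed
    moreover have "\<forall>C\<in>\<Union>B\<in>\<G>. \<C> B. small C"
      using \<C> by simp
    ultimately show ?thesis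
      unfolding good_def by (intro exI conjI)
  qed
  have good_mono: "good B" if "good C" "B \<subseteq> C" for B C
    using that unfolding good_def by blast
  define V where "V = \<Union>{B \<in> \<B>. good B}"
  have V: "openin Z V" "good V"
    unfolding V_def using \<B>(1,2) by (auto intro!: good_Union)
  have "topspace Z \<subseteq> V"
  proof (rule ccontr)
    define A where "A = topspace Z - V"
    assume "\<not> topspace Z \<subseteq> V"
    then have "A \<subseteq> topspace Z" "A \<noteq> {}"
      unfolding A_def by auto
    moreover have "eventually (\<lambda>(s, t). dist s t < e) (uniformity :: ('b \<times> 'b) filter)"
      unfolding eventually_uniformity_metric using e by auto
    ultimately obtain W where W: "openin Z W" "W \<inter> A \<noteq> {}"
        "\<forall>x\<in>W \<inter> A. \<forall>y\<in>W \<inter> A. dist (f x) (f y) < e"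
      using f unfolding fragmented_def by (metis (no_types, lifting) case_prod_conv)
    then obtain z B where z: "z \<in> A" "B \<in> \<B>" "z \<in> B" "B \<subseteq> W"
      using \<B>(3) by blast
    have "closedin Z A"
      unfolding A_def using V(1) by blast
    then have "fsigma_in Z (B \<inter> A)"
      using \<B>(2)[OF z(2)] Z(2)
      by (intro fsigma_in_Int open_imp_fsigma_in closed_imp_fsigma_in)
    then have "small (B \<inter> A)"
      unfolding small_def using W(3) z(4) by blast
    then have "good (B \<inter> A)"
      unfolding good_def by (intro exI[of _ "{B \<inter> A}"]) simp
    then have "good (\<Union>{B \<inter> A, V})"
      using V(2) by (intro good_Union) auto
    then have "good B"
      by (rule good_mono) (use \<B>(2)[OF z(2)] openin_subset A_def in fastforce)
    then show False
      using z unfolding A_def V_def by blast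
  qed
  then have "good (topspace Z)"
    using V(2) good_mono by blast
  then show ?thesis
    unfolding good_def small_def .
qed

text \<open>
  The preimage of an open set is the union of those members of the covers with mesh \<open>1 / (n + 1)\<close>,
  for all \<open>n\<close>, that it contains.
\<close>

lemma fragmented_imp_Baire_class_1:
  assumes Z: "second_countable Z" "metrizable_space Z"
    and f: "fragmented Z uniformity f" "f \<in> extensional (topspace Z)"
  shows "f \<in> Baire_class_1 Z"
  unfolding Baire_class_1_def
proof (intro CollectI conjI allI impI f(2))
  fix U :: "real set" assume U: "open U"
  have "\<exists>\<C>. countable \<C> \<and> topspace Z \<subseteq> \<Union>\<C> \<and>
      (\<forall>C\<in>\<C>. fsigma_in Z C \<and> (\<forall>x\<in>C. \<forall>y\<in>C. dist (f x) (f y) < 1 / Suc n))" for n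
    using fragmented_countable_fsigma_cover[OF Z f(1)] by simp
  then obtain \<C> where \<C>: "\<And>n. countable (\<C> n)" "\<And>n. topspace Z \<subseteq> \<Union>(\<C> n)"
      "\<And>n C. C \<in> \<C> n \<Longrightarrow> fsigma_in Z C"
      "\<And>n C x y. C \<in> \<C> n \<Longrightarrow> x \<in> C \<Longrightarrow> y \<in> C \<Longrightarrow> dist (f x) (f y) < 1 / Suc n"
    by metis
  define P where "P = {z \<in> topspace Z. f z \<in> U}"
  have "P \<subseteq> \<Union>{C \<in> \<Union>(range \<C>). C \<subseteq> P}"
  proof
    fix z assume z: "z \<in> P"
    then obtain r where r: "r > 0" "ball (f z) r \<subseteq> U"
      using U openE unfolding P_def by blast
    then obtain n where n: "1 / Suc n < r"
      using nat_approx_posE by blast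
    obtain C where C: "C \<in> \<C> n" "z \<in> C"
      using \<C>(2)[of n] z unfolding P_def by blast
    have "C \<subseteq> P"
      using \<C>(4)[OF C] \<C>(3)[OF C(1)] fsigma_in_subset r(2) n unfolding P_def
      by (smt (verit, best) mem_Collect_eq mem_ball subset_iff)
    then show "z \<in> \<Union>{C \<in> \<Union>(range \<C>). C \<subseteq> P}"
      using C by blast
  qed
  then have "P = \<Union>{C \<in> \<Union>(range \<C>). C \<subseteq> P}"
    by blast
  moreover have "fsigma_in Z (\<Union>{C \<in> \<Union>(range \<C>). C \<subseteq> P})"
  proof (rule fsigma_in_Union)
    have "countable (\<Union>(range \<C>))"
      using \<C>(1) by simp
    then show "countable {C \<in> \<Union>(range \<C>). C \<subseteq> P}"
      by (rule countable_subset[rotated]) blast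
  qed (use \<C>(3) in blast)
  ultimately show "fsigma_in Z {z \<in> topspace Z. f z \<in> U}"
    unfolding P_def by simp
qed

section \<open>Counting Baire class 1 functions\<close>

lemma separable_metrizable_imp_second_countable:
  assumes "metrizable_space Z" "separable_space Z"
  shows "second_countable Z"
proof -
  obtain M d where "Metric_space M d" and Z: "Z = Metric_space.mtopology M d"
    using assms(1) unfolding metrizable_space_def by blast
  then interpret Metric_space M d by simp
  obtain C where C: "countable C" "C \<subseteq> M" "mtopology closure_of C = M"
    using assms(2) unfolding separable_space_def Z by auto
  define \<B> where "\<B> = (\<lambda>(c, n). mball c (1 / Suc n)) ` (C \<times> (UNIV :: nat set))"
  have "countable \<B>"
    unfolding \<B>_def using C(1) by simp
  moreover have "openin mtopology V" if "V \<in> \<B>" for V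
    using that unfolding \<B>_def by auto
  moreover have "\<exists>V\<in>\<B>. x \<in> V \<and> V \<subseteq> U" if U: "openin mtopology U" "x \<in> U" for U x
  proof -
    obtain r where r: "r > 0" "mball x r \<subseteq> U"
      using U unfolding openin_mtopology by blast
    obtain n where n: "1 / Suc n < r / 2"
      using nat_approx_posE[of "r / 2"] r(1) by auto
    have "x \<in> M"
      using U openin_mtopology by blast
    then have "x \<in> mtopology closure_of C"
      using C(3) by simp
    then obtain c where c: "c \<in> C" "c \<in> mball x (1 / Suc n)"
      unfolding metric_closure_of by (auto dest!: spec[of _ "1 / Suc n"])
    then have cx: "d c x < 1 / Suc n" "c \<in> M"
      by (auto simp: commute)
    have "mball c (1 / Suc n) \<subseteq> mball x r"
    proof
      fix y assume y: "y \<in> mball c (1 / Suc n)"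
      then have "d x y \<le> d x c + d c y"
        using \<open>x \<in> M\<close> cx by (intro triangle) auto
      then show "y \<in> mball x r"
        using y cx n \<open>x \<in> M\<close> commute[of x c] by auto
    qed
    moreover have "x \<in> mball c (1 / Suc n)"
      using cx \<open>x \<in> M\<close> by simp
    moreover have "mball c (1 / Suc n) \<in> \<B>"
      unfolding \<B>_def using c(1) by (intro image_eqI[of _ _ "(c, n)"]) simp_all
    ultimately show ?thesis
      using r(2) by (meson subset_trans)
  qed
  ultimately show ?thesis
    unfolding second_countable_def Z by (intro exI[of _ \<B>] conjI) simp_all
qed

text \<open>
  A Baire class 1 function is determined by its sets \<open>{z. q < f z}\<close> with rational \<open>q\<close>, each of these
  by a sequence of closed sets, and each closed set by the basic open sets that miss it.
\<close>

lemma Baire_class_1_inj_nat_set: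
  assumes "second_countable Z"
  shows "\<exists>c :: ('z \<Rightarrow> real) \<Rightarrow> nat set. inj_on c (Baire_class_1 Z)"
proof -
  obtain \<B> where \<B>: "countable \<B>" "\<And>V. V \<in> \<B> \<Longrightarrow> openin Z V"
      "\<And>U x. openin Z U \<Longrightarrow> x \<in> U \<Longrightarrow> \<exists>V\<in>\<B>. x \<in> V \<and> V \<subseteq> U"
    using assms unfolding second_countable_def by metis
  have ex: "\<exists>C :: nat \<Rightarrow> 'z set. (\<forall>n. closedin Z (C n)) \<and> \<Union>(range C) = {z \<in> topspace Z. q < f z}"
    if "f \<in> Baire_class_1 Z" for f :: "'z \<Rightarrow> real" and q
  proof -
    have "fsigma_in Z {z \<in> topspace Z. f z \<in> {q<..}}"
      using that open_greaterThan unfolding Baire_class_1_def by blast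
    then show ?thesis
      unfolding fsigma_in_ascending by auto
  qed
  define C where "C f q = (SOME C :: nat \<Rightarrow> 'z set. (\<forall>n. closedin Z (C n)) \<and>
      \<Union>(range C) = {z \<in> topspace Z. q < f z})" for f and q :: real
  have C: "closedin Z (C f q n)" "(\<Union>n. C f q n) = {z \<in> topspace Z. q < f z}"
    if "f \<in> Baire_class_1 Z" for f q n
    using someI_ex[OF ex[OF that, of q]] unfolding C_def[symmetric] by blast+
  define I where "I = (\<rat> :: real set) \<times> (UNIV :: nat set) \<times> \<B>"
  have I: "countable I"
    unfolding I_def using \<B>(1) countable_rat by blast
  define code where "code f = {(q, n, B). (q, n, B) \<in> I \<and> B \<inter> C f q n = {}}" for f
  have C_code: "C f q n = {z \<in> topspace Z. \<nexists>B. z \<in> B \<and> (q, n, B) \<in> code f}"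
    if f: "f \<in> Baire_class_1 Z" and q: "q \<in> \<rat>" for f q n
  proof -
    have "\<exists>B. z \<in> B \<and> (q, n, B) \<in> code f" if z: "z \<in> topspace Z" "z \<notin> C f q n" for z
    proof -
      have "openin Z (topspace Z - C f q n)"
        using C(1)[OF f] by blast
      then obtain B where "B \<in> \<B>" "z \<in> B" "B \<subseteq> topspace Z - C f q n"
        using \<B>(3)[of _ z] z by blast
      then show ?thesis
        using q unfolding code_def I_def by blast
    qed
    then show ?thesis
      using closedin_subset[OF C(1)[OF f]] unfolding code_def by blast
  qed
  have "inj_on code (Baire_class_1 Z)"
  proof (rule inj_onI)
    fix f g assume fg: "f \<in> Baire_class_1 Z" "g \<in> Baire_class_1 Z" "code f = code g"
    have "{z \<in> topspace Z. q < f z} = {z \<in> topspace Z. q < g z}" if "q \<in> \<rat>" for q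
      using C_code[OF fg(1) that] C_code[OF fg(2) that] fg(3) C(2)[OF fg(1), of q]
        C(2)[OF fg(2), of q] by simp
    then have lt: "q < f z \<longleftrightarrow> q < g z" if "q \<in> \<rat>" "z \<in> topspace Z" for q z
      using that by blast
    have "f z = g z" if "z \<in> topspace Z" for z
      using lt[OF _ that] Rats_dense_in_real[of "f z" "g z"] Rats_dense_in_real[of "g z" "f z"]
      by (meson less_asym linorder_neqE_linordered_idom)
    then show "f = g"
      using fg(1,2) unfolding Baire_class_1_def by (blast intro: extensionalityI)
  qed
  moreover have "inj_on (\<lambda>S. to_nat_on I ` S) (code ` Baire_class_1 Z)"
  proof (rule inj_on_subset)
    show "inj_on (\<lambda>S. to_nat_on I ` S) (Pow I)"
      using inj_on_image_Pow inj_on_to_nat_on[OF I] by blast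
    show "code ` Baire_class_1 Z \<subseteq> Pow I"
      unfolding code_def by auto
  qed
  ultimately have "inj_on ((`) (to_nat_on I) \<circ> code) (Baire_class_1 Z)"
    by (rule comp_inj_on)
  then show ?thesis
    by (intro exI)
qed

section \<open>Independent families of functions\<close>

text \<open>
  If every \<open>P i\<close> were nowhere dense in \<open>A\<close>, a nonempty relatively open subset of \<open>A\<close> could be shrunk
  finitely many times until it avoids all of them. For finite covers this replaces the Baire category
  theorem, so that \<open>A\<close> can be arbitrary.
\<close>

lemma finite_cover_somewhere_dense:
  assumes "finite I" "A \<subseteq> topspace X" "A \<noteq> {}" "A \<subseteq> (\<Union>i\<in>I. P i)"
  shows "\<exists>i\<in>I. \<exists>W. openin X W \<and> W \<inter> A \<noteq> {} \<and>
           (\<forall>V. openin X V \<and> V \<subseteq> W \<and> V \<inter> A \<noteq> {} \<longrightarrow> V \<inter> A \<inter> P i \<noteq> {})"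
proof (rule ccontr)
  assume nowhere: "\<not> ?thesis"
  have avoid: "\<exists>V. openin X V \<and> V \<subseteq> W \<and> V \<inter> A \<noteq> {} \<and> V \<inter> A \<inter> P i = {}"
    if "i \<in> I" "openin X W" "W \<inter> A \<noteq> {}" for i W
  proof (rule ccontr)
    assume "\<not> ?thesis"
    then have "\<forall>V. openin X V \<and> V \<subseteq> W \<and> V \<inter> A \<noteq> {} \<longrightarrow> V \<inter> A \<inter> P i \<noteq> {}"
      by (simp only: not_ex de_Morgan_conj not_not) metis
    with that(2,3) have "\<exists>W. openin X W \<and> W \<inter> A \<noteq> {} \<and>
        (\<forall>V. openin X V \<and> V \<subseteq> W \<and> V \<inter> A \<noteq> {} \<longrightarrow> V \<inter> A \<inter> P i \<noteq> {})"
      by (intro exI[of _ W] conjI)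
    with that(1) have "\<exists>i\<in>I. \<exists>W. openin X W \<and> W \<inter> A \<noteq> {} \<and>
        (\<forall>V. openin X V \<and> V \<subseteq> W \<and> V \<inter> A \<noteq> {} \<longrightarrow> V \<inter> A \<inter> P i \<noteq> {})"
      by (rule bexI[rotated])
    with nowhere show False ..
  qed
  have "\<exists>W. openin X W \<and> W \<inter> A \<noteq> {} \<and> W \<inter> A \<inter> (\<Union>j\<in>J. P j) = {}" if "finite J" "J \<subseteq> I" for J
    using that
  proof (induction J)
    case empty
    have "topspace X \<inter> A \<noteq> {}"
      using assms(2,3) by blast
    then show ?case
      by (intro exI[of _ "topspace X"]) simp
  next
    case (insert j J)
    then obtain W where W: "openin X W" "W \<inter> A \<noteq> {}" "W \<inter> A \<inter> (\<Union>j\<in>J. P j) = {}"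
      by auto
    then obtain V where "openin X V" "V \<subseteq> W" "V \<inter> A \<noteq> {}" "V \<inter> A \<inter> P j = {}"
      using avoid[of j W] insert.prems by blast
    then show ?case
      using W(3) by (intro exI[of _ V]) blast
  qed
  then obtain W where "W \<inter> A \<noteq> {}" "W \<inter> A \<inter> (\<Union>i\<in>I. P i) = {}"
    using assms(1) by (meson subset_refl)
  with assms(4) show False
    by auto
qed

text \<open>
  Cover the space by finitely many balls \<open>mball c (r c)\<close> whose doubles are small with respect to the
  entourage that witnesses the failure of fragmentedness. The preimage under \<open>p\<close> of one of these
  balls is dense in some relatively open part of \<open>A\<close>. No nonempty relatively open subset of \<open>A\<close> is
  mapped into the doubled ball, so the points with values outside it are dense there as well.
\<close>

lemma (in Metric_space) not_fragmented_imp_oscillation: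
  assumes comp: "compact_space mtopology" and p: "p ` M \<subseteq> M"
    and nf: "\<not> fragmented mtopology (compact_uniformity mtopology) p"
  shows "\<exists>c\<in>M. \<exists>a b. a < b \<and> (\<exists>A \<subseteq> M. A \<noteq> {} \<and>
    (\<forall>W. openin mtopology W \<and> W \<inter> A \<noteq> {} \<longrightarrow>
      (\<exists>x\<in>W \<inter> A. d c (p x) < a) \<and> (\<exists>x\<in>W \<inter> A. b < d c (p x))))"
proof -
  obtain A E where A: "A \<subseteq> M" "A \<noteq> {}" and E: "eventually E (compact_uniformity mtopology)"
    and nsmall: "\<not> (\<exists>W. openin mtopology W \<and> W \<inter> A \<noteq> {} \<and> (\<forall>x\<in>W \<inter> A. \<forall>y\<in>W \<inter> A. E (p x, p y)))"
    using nf unfolding fragmented_def topspace_mtopology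
    by (simp only: not_all not_imp) (elim exE conjE)
  have osc: "\<exists>x\<in>W \<inter> A. \<exists>y\<in>W \<inter> A. \<not> E (p x, p y)" if "openin mtopology W" "W \<inter> A \<noteq> {}" for W
    using nsmall that by blast
  obtain U where U: "openin (prod_topology mtopology mtopology) U" "Id_on M \<subseteq> U" "\<forall>q\<in>U. E q"
    using compact_uniformityE[OF E] by (metis topspace_mtopology)
  have "\<exists>r>0. mball c (2 * r) \<times> mball c (2 * r) \<subseteq> U" if c: "c \<in> M" for c
  proof -
    have "(c, c) \<in> U"
      using U(2) c by blast
    then obtain V W where VW: "openin mtopology V" "openin mtopology W" "c \<in> V" "c \<in> W" "V \<times> W \<subseteq> U"
      using U(1) unfolding openin_prod_topology_alt by metis
    then obtain r s where rs: "r > 0" "mball c r \<subseteq> V" "s > 0" "mball c s \<subseteq> W"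
      unfolding openin_mtopology by metis
    have "mball c (2 * (min r s / 2)) \<subseteq> V \<inter> W"
      using rs mball_subset_concentric[of "min r s" r c] mball_subset_concentric[of "min r s" s c] by auto
    then show ?thesis
      using VW(5) rs by (intro exI[of _ "min r s / 2"]) auto
  qed
  then obtain r where r: "\<And>c. c \<in> M \<Longrightarrow> r c > 0" "\<And>c. c \<in> M \<Longrightarrow> mball c (2 * r c) \<times> mball c (2 * r c) \<subseteq> U"
    by metis
  have "M \<subseteq> \<Union>((\<lambda>c. mball c (r c)) ` M)"
    using r(1) by auto
  then obtain \<F> where \<F>: "finite \<F>" "\<F> \<subseteq> (\<lambda>c. mball c (r c)) ` M" "M \<subseteq> \<Union>\<F>"
    using comp unfolding compact_space_alt topspace_mtopology
    by (metis (no_types, lifting) imageE openin_mball)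
  then obtain I where I: "finite I" "I \<subseteq> M" "\<F> = (\<lambda>c. mball c (r c)) ` I"
    by (meson finite_subset_image)
  have "A \<subseteq> (\<Union>c\<in>I. {x. p x \<in> mball c (r c)})"
    using A(1) p \<F>(3) I(3) by blast
  then have "\<exists>c\<in>I. \<exists>W. openin mtopology W \<and> W \<inter> A \<noteq> {} \<and>
      (\<forall>V. openin mtopology V \<and> V \<subseteq> W \<and> V \<inter> A \<noteq> {} \<longrightarrow> V \<inter> A \<inter> {x. p x \<in> mball c (r c)} \<noteq> {})"
    using A by (intro finite_cover_somewhere_dense[OF I(1)]) simp_all
  then obtain c W where c: "c \<in> I" and W: "openin mtopology W" "W \<inter> A \<noteq> {}" and
    near: "\<forall>V. openin mtopology V \<and> V \<subseteq> W \<and> V \<inter> A \<noteq> {} \<longrightarrow> V \<inter> A \<inter> {x. p x \<in> mball c (r c)} \<noteq> {}"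
    by (elim bexE exE conjE)
  have cM: "c \<in> M"
    using c I(2) by blast
  show ?thesis
  proof (intro bexI[OF _ cM] exI conjI allI impI)
    \<comment> \<open>any threshold strictly between \<open>r c\<close> and \<open>2 * r c\<close> would do as \<open>b\<close>\<close>
    show "r c < 3 / 2 * r c"
      using r(1)[OF cM] by simp
    show "W \<inter> A \<subseteq> M" "W \<inter> A \<noteq> {}"
      using A W by auto
    fix V assume V: "openin mtopology V \<and> V \<inter> (W \<inter> A) \<noteq> {}"
    then have VW: "openin mtopology (V \<inter> W)" "(V \<inter> W) \<inter> A \<noteq> {}"
      using W(1) by (auto intro: openin_Int)
    have "V \<inter> W \<inter> A \<inter> {x. p x \<in> mball c (r c)} \<noteq> {}"
      using near VW by simp
    then show "\<exists>x\<in>V \<inter> (W \<inter> A). d c (p x) < r c"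
      by auto
    obtain x y where xy: "x \<in> V \<inter> W \<inter> A" "y \<in> V \<inter> W \<inter> A" "\<not> E (p x, p y)"
      using osc[OF VW] by blast
    then have "p x \<notin> mball c (2 * r c) \<or> p y \<notin> mball c (2 * r c)"
      using r(2)[OF cM] U(3) by blast
    moreover have "p x \<in> M" "p y \<in> M"
      using xy(1,2) A(1) p by blast+
    ultimately have "2 * r c \<le> d c (p x) \<or> 2 * r c \<le> d c (p y)"
      using cM by auto
    then have "3 / 2 * r c < d c (p x) \<or> 3 / 2 * r c < d c (p y)"
      using r(1)[OF cM] by auto
    then show "\<exists>x\<in>V \<inter> (W \<inter> A). 3 / 2 * r c < d c (p x)"
      using xy(1,2) by blast
  qed
qed

text \<open>
  Here \<open>q\<close> is to be thought of as a pointwise limit of \<open>H\<close>. Every sign pattern of the functions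
  chosen so far holds on an open set that meets \<open>A\<close>, and this set contains both a point of \<open>A\<close> with
  \<open>q x < a\<close> and one with \<open>b < q x\<close>. As these are finitely many points, a single member of \<open>H\<close> that
  satisfies the same inequalities as \<open>q\<close> there extends each pattern in both ways.
\<close>

lemma independent_sequence_if_dense:
  fixes q :: "'a \<Rightarrow> real"
  assumes cont: "\<And>h. h \<in> H \<Longrightarrow> continuous_map X euclideanreal h"
    and approx: "\<And>F. finite F \<Longrightarrow> F \<subseteq> topspace X \<Longrightarrow>
        \<exists>h\<in>H. \<forall>x\<in>F. (q x < a \<longrightarrow> h x < a) \<and> (b < q x \<longrightarrow> b < h x)"
    and A: "A \<subseteq> topspace X" "A \<noteq> {}"
    and dense: "\<And>W. openin X W \<Longrightarrow> W \<inter> A \<noteq> {} \<Longrightarrow>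
        (\<exists>x\<in>W \<inter> A. q x < a) \<and> (\<exists>x\<in>W \<inter> A. b < q x)"
  shows "\<exists>h :: nat \<Rightarrow> 'a \<Rightarrow> real. range h \<subseteq> H \<and>
           (\<forall>n s. \<exists>x\<in>A. \<forall>i<n. if i \<in> s then h i x < a else b < h i x)"
proof -
  define P where "P n h \<longleftrightarrow> (\<forall>i<n. h i \<in> H) \<and>
      (\<forall>s. \<exists>x\<in>A. \<forall>i<n. if i \<in> s then h i x < a else b < h i x)" for n and h :: "nat \<Rightarrow> 'a \<Rightarrow> real"
  have "\<exists>g. \<forall>n. P n (g n) \<and> (\<forall>i<n. g (Suc n) i = g n i)"
  proof (rule dependent_nat_choice)
    show "\<exists>h. P 0 h"
      using A(2) unfolding P_def by auto
    fix h n assume h: "P n h"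
    define Q where "Q s = {x \<in> topspace X. \<forall>i<n. if i \<in> s then h i x < a else b < h i x}" for s
    have "openin X {x \<in> topspace X. \<forall>i<m. if i \<in> s then h i x < a else b < h i x}" if "m \<le> n" for m s
      using that
    proof (induction m)
      case (Suc m)
      have "continuous_map X euclideanreal (h m)"
        using h Suc.prems cont unfolding P_def by auto
      then have "openin X {x \<in> topspace X. h m x \<in> (if m \<in> s then {..<a} else {b<..})}"
        by (rule openin_continuous_map_preimage) auto
      moreover have "{x \<in> topspace X. \<forall>i<Suc m. if i \<in> s then h i x < a else b < h i x} =
          {x \<in> topspace X. \<forall>i<m. if i \<in> s then h i x < a else b < h i x} \<inter>
          {x \<in> topspace X. h m x \<in> (if m \<in> s then {..<a} else {b<..})}"
        by (auto simp: less_Suc_eq)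
      ultimately show ?case
        using Suc by (simp add: openin_Int)
    qed auto
    then have "openin X (Q s)" for s
      unfolding Q_def by blast
    moreover have "Q s \<inter> A \<noteq> {}" for s
    proof -
      obtain x where "x \<in> A" "\<forall>i<n. if i \<in> s then h i x < a else b < h i x"
        using h unfolding P_def by blast
      then have "x \<in> Q s \<inter> A"
        using A(1) unfolding Q_def by blast
      then show ?thesis by blast
    qed
    ultimately have Q: "openin X (Q s)" "Q s \<inter> A \<noteq> {}" for s
      by blast+
    then have "\<exists>x y. x \<in> Q s \<inter> A \<and> q x < a \<and> y \<in> Q s \<inter> A \<and> b < q y" for s
      using dense[OF Q] by blast
    then obtain y z where y: "\<And>s. y s \<in> Q s \<inter> A" "\<And>s. q (y s) < a"
      and z: "\<And>s. z s \<in> Q s \<inter> A" "\<And>s. b < q (z s)"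
      by metis
    have "finite (y ` Pow {..<n} \<union> z ` Pow {..<n})" "y ` Pow {..<n} \<union> z ` Pow {..<n} \<subseteq> topspace X"
      using y(1) z(1) A(1) by auto
    then obtain k where k: "k \<in> H" "\<forall>x\<in>y ` Pow {..<n} \<union> z ` Pow {..<n}. (q x < a \<longrightarrow> k x < a) \<and> (b < q x \<longrightarrow> b < k x)"
      using approx by blast
    \<comment> \<open>only the trace of \<open>s\<close> below \<open>n\<close> matters, so finitely many points \<open>y t\<close> and \<open>z t\<close> serve all \<open>s\<close>\<close>
    have "\<exists>x\<in>A. \<forall>i<Suc n. if i \<in> s then (h(n := k)) i x < a else b < (h(n := k)) i x" for s
    proof -
      define t where "t = s \<inter> {..<n}"
      define x where "x = (if n \<in> s then y t else z t)"
      have "if n \<in> s then k x < a else b < k x"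
        using k(2) y(2)[of t] z(2)[of t] unfolding x_def t_def by auto
      moreover have "x \<in> Q t" "x \<in> A"
        using y(1)[of t] z(1)[of t] unfolding x_def by auto
      then have "\<forall>i<n. if i \<in> s then h i x < a else b < h i x"
        unfolding Q_def t_def by auto
      ultimately show ?thesis
        using \<open>x \<in> A\<close> by (intro bexI[of _ x]) (auto simp: less_Suc_eq)
    qed
    then have "P (Suc n) (h(n := k))"
      using h k(1) unfolding P_def by (auto simp: less_Suc_eq)
    then show "\<exists>h'. P (Suc n) h' \<and> (\<forall>i<n. h' i = h i)"
      by (intro exI[of _ "h(n := k)"]) simp
  qed
  then obtain g where g: "\<And>n. P n (g n)" "\<And>n i. i < n \<Longrightarrow> g (Suc n) i = g n i"
    by metis
  define h where "h n = g (Suc n) n" for n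
  have gh: "g n i = h i" if "i < n" for n i
    using that by (induction n) (auto simp: h_def less_Suc_eq g(2))
  have "h i \<in> H" for i
    using g(1)[of "Suc i"] unfolding P_def h_def by auto
  moreover have "\<exists>x\<in>A. \<forall>i<n. if i \<in> s then h i x < a else b < h i x" for n s
    using g(1)[of n] gh[of _ n] unfolding P_def by metis
  ultimately show ?thesis
    by blast
qed

lemma compact_space_realizes_pattern:
  fixes e :: "'i \<Rightarrow> 'k \<Rightarrow> real"
  assumes K: "compact_space K"
    and cont: "\<And>i. continuous_map K euclideanreal (e i)"
    and fin: "\<And>J. finite J \<Longrightarrow> \<exists>k\<in>topspace K. \<forall>i\<in>J. if i \<in> D then e i k \<le> a else b \<le> e i k"
  shows "\<exists>k\<in>topspace K. \<forall>i. if i \<in> D then e i k \<le> a else b \<le> e i k"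
proof -
  define C where "C i = {k \<in> topspace K. e i k \<in> (if i \<in> D then {..a} else {b..})}" for i
  have "closedin K (C i)" for i
    unfolding C_def using cont by (rule closedin_continuous_map_preimage) auto
  moreover have "\<Inter>\<F> \<noteq> {}" if \<F>: "finite \<F>" "\<F> \<subseteq> range C" for \<F>
  proof -
    obtain J where J: "finite J" "\<F> = C ` J"
      using finite_subset_image[OF \<F>] by blast
    obtain k where "k \<in> topspace K" "\<forall>i\<in>J. if i \<in> D then e i k \<le> a else b \<le> e i k"
      using fin[OF J(1)] by blast
    then have "k \<in> \<Inter>\<F>"
      unfolding J(2) C_def by auto
    then show ?thesis by blast
  qed
  ultimately have "\<Inter>(range C) \<noteq> {}"
    using K unfolding compact_space_fip by (metis (no_types, lifting) imageE)
  then obtain k where k: "k \<in> C i" for i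
    by blast
  have "if i \<in> D then e i k \<le> a else b \<le> e i k" for i
    using k[of i] unfolding C_def by (auto split: if_splits)
  moreover have "k \<in> topspace K"
    using k[of undefined] unfolding C_def by blast
  ultimately show ?thesis by blast
qed

text \<open>
  The classical independent family of Fichtenholz and Kantorovich: a natural number codes a length
  \<open>n\<close> together with a finite list of subsets of \<open>{..<n}\<close>, and it belongs to \<open>N S\<close> if the trace of \<open>S\<close>
  on \<open>{..<n}\<close> is on the list. Finitely many sets have distinct traces for large \<open>n\<close>.
\<close>

lemma independent_family_nat:
  "\<exists>N :: nat set \<Rightarrow> nat set. \<forall>J D. finite J \<longrightarrow> (\<exists>m. \<forall>S\<in>J. m \<in> N S \<longleftrightarrow> S \<in> D)"
proof -
  define trace where "trace n S = map (\<lambda>i. i \<in> S) [0..<n]" for n and S :: "nat set"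
  define N where "N S = {to_nat (n, L) | n L. trace n S \<in> set L}" for S
  have "\<exists>m. \<forall>S\<in>J. m \<in> N S \<longleftrightarrow> S \<in> D" if J: "finite J" for J D
  proof -
    \<comment> \<open>a place where the two sets differ; all traces are taken beyond all these places\<close>
    define i where "i = (\<lambda>(S, T). SOME i :: nat. i \<in> S \<longleftrightarrow> i \<notin> T)"
    have i: "i (S, T) \<in> S \<longleftrightarrow> i (S, T) \<notin> T" if "S \<noteq> T" for S T
      using someI_ex[of "\<lambda>i. i \<in> S \<longleftrightarrow> i \<notin> T"] that unfolding i_def by auto
    define n where "n = Suc (Max (insert 0 (i ` (J \<times> J))))"
    have "i (S, T) < n" if "S \<in> J" "T \<in> J" for S T
      unfolding n_def less_Suc_eq_le using J that by (intro Max_ge) auto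
    then have sep: "trace n S \<noteq> trace n T" if "S \<in> J" "T \<in> J" "S \<noteq> T" for S T
      using i[OF that(3)] that(1,2) unfolding trace_def by auto
    obtain L where L: "set L = trace n ` (J \<inter> D)"
      using finite_list[of "trace n ` (J \<inter> D)"] J by auto
    have "to_nat (n, L) \<in> N S \<longleftrightarrow> S \<in> D" if "S \<in> J" for S
    proof -
      have "to_nat (n, L) \<in> N S \<longleftrightarrow> trace n S \<in> set L"
        unfolding N_def by auto
      also have "\<dots> \<longleftrightarrow> S \<in> D"
        unfolding L using sep that by blast
      finally show ?thesis .
    qed
    then show ?thesis by blast
  qed
  then show ?thesis by blast
qed

section \<open>Envelopes of families of continuous maps\<close>

lemma closure_of_product_approx:
  assumes p: "p \<in> product_topology (\<lambda>_. X) S closure_of \<Phi>"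
    and F: "finite F" "F \<subseteq> S" "\<And>x. x \<in> F \<Longrightarrow> openin X (V x) \<and> p x \<in> V x"
  shows "\<exists>g\<in>\<Phi>. \<forall>x\<in>F. g x \<in> V x"
proof -
  define Q where "Q = (\<Pi>\<^sub>E x\<in>S. if x \<in> F then V x else topspace X)"
  have "p \<in> (\<Pi>\<^sub>E x\<in>S. topspace X)"
    using p closure_of_subset_topspace by fastforce
  then have "p \<in> Q"
    using F(3) unfolding Q_def by (auto simp: PiE_iff)
  moreover have "finite {x \<in> S. (if x \<in> F then V x else topspace X) \<noteq> topspace X}"
    using F(1) by (rule rev_finite_subset) auto
  then have "openin (product_topology (\<lambda>_. X) S) Q"
    unfolding Q_def openin_PiE_gen using F(3) by auto
  ultimately obtain g where g: "g \<in> \<Phi>" "g \<in> Q"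
    using p unfolding in_closure_of by blast
  have "g x \<in> V x" if "x \<in> F" for x
    using PiE_mem[OF g(2)[unfolded Q_def], of x] that F(2) by auto
  then show ?thesis
    using g(1) by blast
qed

lemma compact_Hausdorff_closure_of_product:
  assumes "compact_space X" "Hausdorff_space X"
  shows "compact_space (subtopology (product_topology (\<lambda>_. X) S) (product_topology (\<lambda>_. X) S closure_of \<Phi>))"
    and "Hausdorff_space (subtopology (product_topology (\<lambda>_. X) S) (product_topology (\<lambda>_. X) S closure_of \<Phi>))"
proof -
  have "compact_space (product_topology (\<lambda>_. X) S)"
    using assms(1) by (simp add: compact_space_product_topology)
  then show "compact_space (subtopology (product_topology (\<lambda>_. X) S) (product_topology (\<lambda>_. X) S closure_of \<Phi>))"
    by (intro compact_space_subtopology closedin_compact_space) auto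
  show "Hausdorff_space (subtopology (product_topology (\<lambda>_. X) S) (product_topology (\<lambda>_. X) S closure_of \<Phi>))"
    using assms(2) by (intro Hausdorff_space_subtopology) (simp add: Hausdorff_space_product_topology)
qed

text \<open>
  Compactness is used twice, with points and functions exchanging their roles: first on the space, to
  turn finite patterns of the independent sequence \<open>g\<close> into points \<open>x s\<close> with a prescribed infinite
  pattern; then on the closure, to find maps with arbitrary values at the points \<open>x (N S)\<close>. For a
  finite set of such points, a suitable member of the sequence \<open>g\<close> itself has the desired values.
\<close>

lemma (in Metric_space) not_fragmented_imp_large_closure:
  fixes \<Phi> :: "('a \<Rightarrow> 'a) set"
  defines "E \<equiv> product_topology (\<lambda>_. mtopology) M closure_of \<Phi>"
  assumes comp: "compact_space mtopology"
    and \<Phi>: "\<And>g. g \<in> \<Phi> \<Longrightarrow> g \<in> extensional M \<and> continuous_map mtopology mtopology g"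
    and p: "p \<in> E" and nf: "\<not> fragmented mtopology (compact_uniformity mtopology) p"
  shows "\<exists>r :: ('a \<Rightarrow> 'a) \<Rightarrow> nat set set. r ` E = UNIV"
proof -
  let ?\<Pi> = "product_topology (\<lambda>_. mtopology) M"
  have E_top: "E \<subseteq> (\<Pi>\<^sub>E x\<in>M. M)"
    unfolding E_def using closure_of_subset_topspace[of ?\<Pi>] by simp
  have \<Phi>E: "\<Phi> \<subseteq> E"
    unfolding E_def using \<Phi> by (intro closure_of_subset) (fastforce simp: PiE_iff continuous_map_def)
  have cont_d: "continuous_map mtopology euclideanreal (d c)" if "c \<in> M" for c
    using continuous_on_mdist[of c "metric (M, d)"] that by (simp add: mtopology_of_def)
  have "p ` M \<subseteq> M"
    using p E_top by blast
  then obtain c a b A where c: "c \<in> M" and ab: "a < b" and A: "A \<subseteq> M" "A \<noteq> {}" and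
    dense: "\<And>W. openin mtopology W \<Longrightarrow> W \<inter> A \<noteq> {} \<Longrightarrow>
      (\<exists>x\<in>W \<inter> A. d c (p x) < a) \<and> (\<exists>x\<in>W \<inter> A. b < d c (p x))"
    using not_fragmented_imp_oscillation[OF comp _ nf] by metis
  have open_d: "openin mtopology {y \<in> M. d c y \<in> U}" if "open U" for U
    using openin_continuous_map_preimage[OF cont_d[OF c], of U] that by simp
  have "\<exists>h :: nat \<Rightarrow> 'a \<Rightarrow> real. range h \<subseteq> (\<lambda>g x. d c (g x)) ` \<Phi> \<and>
      (\<forall>n s. \<exists>x\<in>A. \<forall>i<n. if i \<in> s then h i x < a else b < h i x)"
  proof (rule independent_sequence_if_dense[where X = mtopology and q = "\<lambda>x. d c (p x)"])
    fix h assume "h \<in> (\<lambda>g x. d c (g x)) ` \<Phi>"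
    then show "continuous_map mtopology euclideanreal h"
      using \<Phi> continuous_map_compose[OF _ cont_d[OF c]] by (auto simp: comp_def)
  next
    fix F assume F: "finite F" "F \<subseteq> topspace mtopology"
    \<comment> \<open>the open set that records those strict inequalities which \<open>p\<close> satisfies at \<open>x\<close>\<close>
    define V where "V x = {y \<in> M. d c y \<in> (if d c (p x) < a then {..<a} else if b < d c (p x) then {b<..} else UNIV)}" for x
    have "openin mtopology (V x)" for x
      unfolding V_def by (rule open_d) auto
    moreover have "p x \<in> V x" if "x \<in> F" for x
      using that F(2) \<open>p ` M \<subseteq> M\<close> unfolding V_def by auto
    ultimately obtain g where g: "g \<in> \<Phi>" "\<forall>x\<in>F. g x \<in> V x"
      using closure_of_product_approx[OF p[unfolded E_def] F(1), of V] F(2) by auto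
    then show "\<exists>h\<in>(\<lambda>g x. d c (g x)) ` \<Phi>. \<forall>x\<in>F. (d c (p x) < a \<longrightarrow> h x < a) \<and> (b < d c (p x) \<longrightarrow> b < h x)"
      using ab unfolding V_def by (fastforce split: if_splits)
  qed (use A dense in auto)
  then obtain h :: "nat \<Rightarrow> 'a \<Rightarrow> real" where h: "range h \<subseteq> (\<lambda>g x. d c (g x)) ` \<Phi>"
      "\<forall>n s. \<exists>x\<in>A. \<forall>i<n. if i \<in> s then h i x < a else b < h i x"
    by (elim exE conjE)
  have "\<forall>n. \<exists>g. g \<in> \<Phi> \<and> h n = (\<lambda>x. d c (g x))"
    using h(1) by blast
  then obtain g where "\<forall>n. g n \<in> \<Phi> \<and> h n = (\<lambda>x. d c (g n x))"
    by (rule exE[OF choice])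
  then have g: "\<And>n. g n \<in> \<Phi>" "\<And>n x. h n x = d c (g n x)"
    by simp_all
  have "\<exists>x. x \<in> M \<and> (\<forall>n. if n \<in> s then d c (g n x) \<le> a else b \<le> d c (g n x))" for s
  proof -
    have "\<exists>x\<in>topspace mtopology. \<forall>n. if n \<in> s then d c (g n x) \<le> a else b \<le> d c (g n x)"
    proof (rule compact_space_realizes_pattern[OF comp])
      show "continuous_map mtopology euclideanreal (\<lambda>x. d c (g n x))" for n
        using \<Phi>[OF g(1)] continuous_map_compose[OF _ cont_d[OF c]] by (auto simp: comp_def)
      fix J :: "nat set" assume "finite J"
      then obtain n where n: "\<And>j. j \<in> J \<Longrightarrow> j < n"
        using finite_nat_bounded by blast
      obtain x where x: "x \<in> A" "\<And>i. i < n \<Longrightarrow> if i \<in> s then h i x < a else b < h i x"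
        using h(2) by blast
      have "if i \<in> s then d c (g i x) \<le> a else b \<le> d c (g i x)" if "i \<in> J" for i
        using x(2)[OF n[OF that]] g(2)[of i x] by (auto split: if_splits)
      then show "\<exists>x\<in>topspace mtopology. \<forall>i\<in>J. if i \<in> s then d c (g i x) \<le> a else b \<le> d c (g i x)"
        unfolding topspace_mtopology using x(1) A(1) by blast
    qed
    then show ?thesis by auto
  qed
  then have "\<forall>s. \<exists>x. x \<in> M \<and> (\<forall>n. if n \<in> s then d c (g n x) \<le> a else b \<le> d c (g n x))"
    by (rule allI)
  then obtain x where "\<forall>s. x s \<in> M \<and> (\<forall>n. if n \<in> s then d c (g n (x s)) \<le> a else b \<le> d c (g n (x s)))"
    by (rule exE[OF choice])
  then have x: "\<And>s. x s \<in> M" "\<And>s n. if n \<in> s then d c (g n (x s)) \<le> a else b \<le> d c (g n (x s))"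
    by blast+
  obtain N :: "nat set \<Rightarrow> nat set" where N: "\<And>J D. finite J \<Longrightarrow> \<exists>m. \<forall>S\<in>J. m \<in> N S \<longleftrightarrow> S \<in> D"
    using independent_family_nat by metis
  have realized: "\<exists>k\<in>E. {S. d c (k (x (N S))) \<le> a} = D" for D
  proof -
    have "\<exists>k\<in>topspace (subtopology ?\<Pi> E). \<forall>S. if S \<in> D then d c (k (x (N S))) \<le> a else b \<le> d c (k (x (N S)))"
    proof (rule compact_space_realizes_pattern)
      show "compact_space (subtopology ?\<Pi> E)"
        unfolding E_def using comp Hausdorff_space_mtopology by (rule compact_Hausdorff_closure_of_product)
      show "continuous_map (subtopology ?\<Pi> E) euclideanreal (\<lambda>k. d c (k (x (N S))))" for S
        using continuous_map_compose[OF continuous_map_product_projection[OF x(1)] cont_d[OF c]]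
        by (intro continuous_map_from_subtopology) (simp add: comp_def)
      fix J :: "nat set set" assume "finite J"
      then obtain m where m: "\<And>S. S \<in> J \<Longrightarrow> m \<in> N S \<longleftrightarrow> S \<in> D"
        using N by metis
      have "if S \<in> D then d c (g m (x (N S))) \<le> a else b \<le> d c (g m (x (N S)))" if "S \<in> J" for S
        using m[OF that] x(2)[of m "N S"] by simp
      moreover have "g m \<in> topspace (subtopology ?\<Pi> E)"
        unfolding topspace_subtopology topspace_product_topology topspace_mtopology
        using g(1) \<Phi>E E_top by blast
      ultimately show "\<exists>k\<in>topspace (subtopology ?\<Pi> E). \<forall>S\<in>J. if S \<in> D then d c (k (x (N S))) \<le> a else b \<le> d c (k (x (N S)))"
        by blast
    qed
    then obtain k where "k \<in> E" and k: "\<forall>S. if S \<in> D then d c (k (x (N S))) \<le> a else b \<le> d c (k (x (N S)))"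
      unfolding topspace_subtopology by (elim bexE IntE)
    have "d c (k (x (N S))) \<le> a \<longleftrightarrow> S \<in> D" for S
      using spec[OF k, of S] ab by (auto split: if_splits)
    then show ?thesis
      using \<open>k \<in> E\<close> by auto
  qed
  have "D \<in> (\<lambda>k. {S. d c (k (x (N S))) \<le> a}) ` E" for D
  proof -
    obtain k where "k \<in> E" "{S. d c (k (x (N S))) \<le> a} = D"
      using realized[of D] by (elim bexE)
    then show ?thesis
      by (intro image_eqI[of _ _ k]) (simp_all only:)
  qed
  then have "(\<lambda>k. {S. d c (k (x (N S))) \<le> a}) ` E = UNIV"
    by (intro UNIV_eq_I[symmetric])
  then show ?thesis
    by (intro exI)
qed

section \<open>The enveloping semigroup as a Rosenthal compactum\<close>

lemma Rosenthal_compactum_inj_nat_set: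
  assumes "Rosenthal_compactum K"
  shows "\<exists>c :: 'k \<Rightarrow> nat set. inj_on c (topspace K)"
proof -
  obtain Z :: "real topology" where Z: "Polish_space Z" "Rosenthal_compactum_on Z K"
    using assms unfolding Rosenthal_compactum_def by blast
  then obtain S where S: "S \<subseteq> Baire_class_1 Z" "K homeomorphic_space subtopology (powertop_real (topspace Z)) S"
    unfolding Rosenthal_compactum_on_def by blast
  obtain h where h: "homeomorphic_map K (subtopology (powertop_real (topspace Z)) S) h"
    using S(2) homeomorphic_space by blast
  have "h ` topspace K \<subseteq> S"
    using homeomorphic_imp_surjective_map[OF h] by auto
  moreover have "second_countable Z"
    using Z(1) unfolding Polish_space_def
    by (intro separable_metrizable_imp_second_countable) (simp_all add: completely_metrizable_imp_metrizable_space)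
  then obtain c :: "(real \<Rightarrow> real) \<Rightarrow> nat set" where "inj_on c (Baire_class_1 Z)"
    using Baire_class_1_inj_nat_set by blast
  ultimately have "inj_on (c \<circ> h) (topspace K)"
    using S(1) homeomorphic_imp_injective_map[OF h] by (meson comp_inj_on inj_on_subset subset_trans)
  then show ?thesis by blast
qed

lemma no_surj_nat_set_set:
  fixes c :: "'k \<Rightarrow> nat set" and r :: "'k \<Rightarrow> nat set set"
  assumes "inj_on c S"
  shows "r ` S \<noteq> UNIV"
proof
  assume "r ` S = UNIV"
  moreover have "(r \<circ> inv_into S c) ` (c ` S) = r ` S"
    unfolding image_image comp_apply using assms by (intro image_cong) simp_all
  ultimately have "range (r \<circ> inv_into S c) = Pow UNIV"
    by (metis (no_types, lifting) Pow_UNIV UNIV_I UNIV_eq_I image_mono subset_UNIV subset_antisym)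
  then show False
    using Cantors_theorem by blast
qed

lemma admissible_imp_Rosenthal_compactum:
  assumes "admissible_Rosenthal_compactum K"
  shows "Rosenthal_compactum K"
proof -
  obtain Z :: "real topology" where K: "compact_space K" "Hausdorff_space K"
    and Z: "compact_space Z" "metrizable_space Z" and "admissible_Rosenthal_compactum_on Z K"
    using assms unfolding admissible_Rosenthal_compactum_def by blast
  then obtain F S where F: "Rosenthal_family Z F" and S: "S \<subseteq> powertop_real (topspace Z) closure_of F"
    and KS: "K homeomorphic_space subtopology (powertop_real (topspace Z)) S"
    unfolding admissible_Rosenthal_compactum_on_def by blast
  obtain M d where "Metric_space M d" and Zd: "Z = Metric_space.mtopology M d"
    using Z(2) unfolding metrizable_space_def by blast
  then interpret Metric_space M d by simp
  have "completely_metrizable_space Z"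
    unfolding Zd using Z(1) unfolding Zd
    by (intro completely_metrizable_space_mtopology compact_space_imp_mcomplete)
  moreover have sep: "separable_space Z"
    using Z by (rule compact_metrizable_imp_separable)
  ultimately have "Polish_space Z"
    unfolding Polish_space_def by blast
  moreover have "S \<subseteq> Baire_class_1 Z"
  proof
    fix f assume "f \<in> S"
    then have f: "f \<in> powertop_real (topspace Z) closure_of F"
      using S by blast
    then have "f \<in> topspace (powertop_real (topspace Z))"
      by (rule subsetD[OF closure_of_subset_topspace])
    then have "f \<in> extensional (topspace Z)"
      by (simp add: PiE_iff)
    moreover have "fragmented Z uniformity f"
      using F f unfolding Rosenthal_family_def by blast
    ultimately show "f \<in> Baire_class_1 Z"
      using fragmented_imp_Baire_class_1[OF separable_metrizable_imp_second_countable[OF Z(2) sep] Z(2)] by blast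
  qed
  moreover have "compactin (powertop_real (topspace Z)) S"
  proof -
    have "compact_space (subtopology (powertop_real (topspace Z)) S)"
      using K(1) KS homeomorphic_compact_space by blast
    moreover have "S \<subseteq> topspace (powertop_real (topspace Z))"
      using S closure_of_subset_topspace by (rule subset_trans)
    ultimately show ?thesis
      by (simp only: compactin_subspace)
  qed
  ultimately show ?thesis
    using K KS unfolding Rosenthal_compactum_def Rosenthal_compactum_on_def by blast
qed

lemma (in Metric_space) eventually_compact_uniformity_less:
  assumes "0 < e"
  shows "eventually (\<lambda>(x, y). d x y < e) (compact_uniformity mtopology)"
proof -
  have "continuous_map (prod_topology mtopology mtopology) euclideanreal (\<lambda>(x, y). d x y)"
    using continuous_map_metric[of "metric (M, d)"] by (simp add: mtopology_of_def)
  then have "openin (prod_topology mtopology mtopology)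
      {z \<in> topspace (prod_topology mtopology mtopology). (case z of (x, y) \<Rightarrow> d x y) \<in> {..<e}}"
    by (rule openin_continuous_map_preimage) simp
  then show ?thesis
    unfolding eventually_compact_uniformity
    by (intro exI conjI) (use assms in auto)
qed

text \<open>
  The embedding is \<open>D\<close>. It is injective, since \<open>D q (x, p x) = d (p x) (q x)\<close> vanishes only if
  \<open>p x = q x\<close>. For fragmentedness of \<open>D p\<close> on a set \<open>A\<close> of pairs, make \<open>p\<close> oscillate little near the
  first coordinate of a point of \<open>A\<close> by fragmentedness on the projection of \<open>A\<close>, and then keep the
  second coordinate in a small ball; the triangle inequality adds the two oscillations.
\<close>

lemma (in Metric_space) closure_admissible_if_fragmented:
  fixes \<Phi> :: "('a \<Rightarrow> 'a) set"
  defines "PX \<equiv> product_topology (\<lambda>_. mtopology) M"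
  assumes comp: "compact_space mtopology"
    and \<Phi>: "\<And>g. g \<in> \<Phi> \<Longrightarrow> g \<in> extensional M \<and> continuous_map mtopology mtopology g"
    and frag: "\<And>p. p \<in> PX closure_of \<Phi> \<Longrightarrow> fragmented mtopology (compact_uniformity mtopology) p"
  shows "admissible_Rosenthal_compactum (subtopology PX (PX closure_of \<Phi>))"
proof -
  define E where "E = PX closure_of \<Phi>"
  define Z where "Z = prod_topology mtopology mtopology"
  define P where "P = powertop_real (topspace Z)"
  define D where "D p = restrict (\<lambda>(x, y). d y (p x)) (M \<times> M)" for p :: "'a \<Rightarrow> 'a"
  have topZ: "topspace Z = M \<times> M"
    unfolding Z_def by simp
  have E_top: "E \<subseteq> (\<Pi>\<^sub>E x\<in>M. M)"
    unfolding E_def PX_def using closure_of_subset_topspace[of "product_topology (\<lambda>_. mtopology) M"] by simp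
  have topPX: "topspace PX = (\<Pi>\<^sub>E x\<in>M. M)"
    unfolding PX_def by simp
  have \<Phi>_top: "\<Phi> \<subseteq> topspace PX"
  proof
    fix g assume "g \<in> \<Phi>"
    then have "g \<in> extensional M" "g \<in> M \<rightarrow> M"
      using \<Phi>[of g] unfolding continuous_map_def by auto
    then show "g \<in> topspace PX"
      unfolding topPX PiE_def by blast
  qed
  then have \<Phi>E: "\<Phi> \<subseteq> E"
    unfolding E_def by (rule closure_of_subset)
  have compE: "compact_space (subtopology PX E)" and HausE: "Hausdorff_space (subtopology PX E)"
    unfolding E_def PX_def using compact_Hausdorff_closure_of_product[OF comp Hausdorff_space_mtopology] by auto
  have HausP: "Hausdorff_space P"
    unfolding P_def by (simp add: Hausdorff_space_product_topology)
  have cont_d: "continuous_map mtopology euclideanreal (d c)" if "c \<in> M" for c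
    using continuous_on_mdist[of c "metric (M, d)"] that by (simp add: mtopology_of_def)
  have D: "continuous_map PX P D"
    unfolding P_def continuous_map_componentwise topZ
  proof (intro conjI ballI)
    show "D ` topspace PX \<subseteq> extensional (M \<times> M)"
      unfolding D_def by auto
    fix z assume "z \<in> M \<times> M"
    then obtain x y where z: "z = (x, y)" "x \<in> M" "y \<in> M" by blast
    have "continuous_map PX euclideanreal (d y \<circ> (\<lambda>p. p x))"
      unfolding PX_def using continuous_map_product_projection[OF z(2)] cont_d[OF z(3)]
      by (rule continuous_map_compose)
    then show "continuous_map PX euclideanreal (\<lambda>p. D p z)"
      using z unfolding D_def by (simp add: comp_def)
  qed
  have inj: "inj_on D E"
  proof (rule inj_onI)
    fix p q assume pq: "p \<in> E" "q \<in> E" "D p = D q"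
    have "p x = q x" if x: "x \<in> M" for x
    proof -
      have M: "p x \<in> M" "q x \<in> M"
        using pq(1,2) E_top x by auto
      have "D p (x, p x) = D q (x, p x)"
        using pq(3) by simp
      then have "d (p x) (p x) = d (p x) (q x)"
        using x M by (simp add: D_def)
      then show ?thesis
        using M by simp
    qed
    moreover have "p \<in> extensional M" "q \<in> extensional M"
      using pq(1,2) E_top by (auto simp: PiE_iff)
    ultimately show "p = q"
      by (blast intro: extensionalityI)
  qed
  have DE_top: "D ` E \<subseteq> topspace P"
    using continuous_map_image_subset_topspace[OF D] E_top topPX by blast
  have topE: "topspace (subtopology PX E) = E"
    using E_top topPX by auto
  have "homeomorphic_map (subtopology PX E) (subtopology P (D ` E)) D"
  proof (rule continuous_imp_homeomorphic_map)
    show "continuous_map (subtopology PX E) (subtopology P (D ` E)) D"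
      using D topE by (auto intro: continuous_map_into_subtopology continuous_map_from_subtopology)
    show "Hausdorff_space (subtopology P (D ` E))"
      using HausP by (rule Hausdorff_space_subtopology)
    show "D ` topspace (subtopology PX E) = topspace (subtopology P (D ` E))"
      unfolding topE using DE_top by auto
    show "inj_on D (topspace (subtopology PX E))"
      unfolding topE by (rule inj)
  qed (rule compE)
  then have homeo: "subtopology PX E homeomorphic_space subtopology P (D ` E)"
    by (rule homeomorphic_map_imp_homeomorphic_space)
  have "compactin P (D ` E)"
    using compE E_top topPX by (intro image_compactin[OF _ D]) (simp add: compactin_subspace)
  then have "closedin P (D ` E)"
    using HausP compactin_imp_closedin by blast
  then have closure_sub: "P closure_of (D ` \<Phi>) \<subseteq> D ` E"
    using \<Phi>E by (intro closure_of_minimal) auto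
  have DE: "D ` E \<subseteq> P closure_of (D ` \<Phi>)"
    unfolding E_def using D by (rule continuous_map_image_closure_subset)
  have fragD: "fragmented Z uniformity (D p)" if p: "p \<in> E" for p
    unfolding fragmented_def
  proof (intro allI impI)
    fix A and Q :: "real \<times> real \<Rightarrow> bool"
    assume "A \<subseteq> topspace Z \<and> A \<noteq> {} \<and> eventually Q uniformity"
    then have A: "A \<subseteq> M \<times> M" "A \<noteq> {}" and "eventually Q uniformity"
      unfolding topZ by auto
    then obtain e where e: "e > 0" "\<And>s t. dist s t < e \<Longrightarrow> Q (s, t)"
      unfolding eventually_uniformity_metric by blast
    have "eventually (\<lambda>(x, y). d x y < e / 2) (compact_uniformity mtopology)"
      using e(1) by (intro eventually_compact_uniformity_less) simp
    moreover have "fst ` A \<subseteq> topspace mtopology" "fst ` A \<noteq> {}"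
      using A by auto
    ultimately have "fst ` A \<subseteq> topspace mtopology \<and> fst ` A \<noteq> {} \<and>
        eventually (\<lambda>(x, y). d x y < e / 2) (compact_uniformity mtopology)"
      by blast
    then have "\<exists>W. openin mtopology W \<and> W \<inter> fst ` A \<noteq> {} \<and>
        (\<forall>x\<in>W \<inter> fst ` A. \<forall>y\<in>W \<inter> fst ` A. case (p x, p y) of (x, y) \<Rightarrow> d x y < e / 2)"
      using frag[OF p[unfolded E_def]] unfolding fragmented_def
      by (elim allE[of _ "fst ` A"] allE[of _ "\<lambda>(x, y). d x y < e / 2"]) simp
    then obtain W where W: "openin mtopology W" "W \<inter> fst ` A \<noteq> {}"
        "\<And>x y. x \<in> W \<inter> fst ` A \<Longrightarrow> y \<in> W \<inter> fst ` A \<Longrightarrow> d (p x) (p y) < e / 2"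
      by auto
    then obtain u v where uv: "(u, v) \<in> A" "u \<in> W"
      by force
    define V where "V = W \<times> mball v (e / 4)"
    have "openin Z V"
      unfolding V_def Z_def using W(1) by (simp add: openin_prod_Times_iff)
    moreover have "(u, v) \<in> V \<inter> A"
      using uv A(1) e(1) unfolding V_def by auto
    moreover have "Q (D p z, D p w)" if "z \<in> V \<inter> A" "w \<in> V \<inter> A" for z w
    proof -
      obtain x y x' y' where z: "z = (x, y)" and w: "w = (x', y')"
        by (cases z, cases w)
      have M: "x \<in> M" "y \<in> M" "x' \<in> M" "y' \<in> M" "v \<in> M"
        using that A(1) uv(1) unfolding z w by auto
      then have pM: "p x \<in> M" "p x' \<in> M"
        using p E_top by auto
      have "x \<in> W \<inter> fst ` A" "x' \<in> W \<inter> fst ` A"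
        using that unfolding z w V_def by force+
      then have "d (p x) (p x') < e / 2"
        by (rule W(3))
      moreover have "d v y < e / 4" "d v y' < e / 4"
        using that unfolding z w V_def by auto
      moreover have "d y y' \<le> d v y + d v y'"
        using triangle'[of y v y'] M commute by simp
      moreover have "d y (p x) \<le> d y y' + d y' (p x)" "d y' (p x) \<le> d y' (p x') + d (p x) (p x')"
          "d y' (p x') \<le> d y y' + d y (p x')" "d y (p x') \<le> d y (p x) + d (p x) (p x')"
        using triangle[of y y' "p x"] triangle[of y' "p x'" "p x"] triangle[of y' y "p x'"]
          triangle[of y "p x" "p x'"] M pM commute[of "p x" "p x'"] commute[of y y'] by simp_all
      ultimately have "dist (D p z) (D p w) < e"
        using M unfolding D_def z w dist_real_def by simp
      then show ?thesis
        by (rule e(2))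
    qed
    ultimately show "\<exists>W. openin Z W \<and> W \<inter> A \<noteq> {} \<and> (\<forall>x\<in>W \<inter> A. \<forall>y\<in>W \<inter> A. Q (D p x, D p y))"
      by blast
  qed
  have "Rosenthal_family Z (D ` \<Phi>)"
    unfolding Rosenthal_family_def
  proof (intro conjI)
    have "continuous_map Z euclideanreal (D g)" if g: "g \<in> \<Phi>" for g
    proof -
      have "continuous_map Z mtopology (\<lambda>z. g (fst z))"
        unfolding Z_def using \<Phi>[OF g] continuous_map_compose[OF continuous_map_fst[of mtopology mtopology], of mtopology g]
        by (simp add: comp_def)
      moreover have "continuous_map Z mtopology snd"
        unfolding Z_def by (rule continuous_map_snd)
      ultimately have "continuous_map Z euclideanreal (\<lambda>z. d (snd z) (g (fst z)))"
        using continuous_map_mdist[of Z "metric (M, d)" snd "\<lambda>z. g (fst z)"] by (simp add: mtopology_of_def)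
      then show ?thesis
        by (rule continuous_map_eq) (auto simp: D_def topZ)
    qed
    then show "D ` \<Phi> \<subseteq> {f \<in> extensional (topspace Z). continuous_map Z euclideanreal f}"
      unfolding topZ by (auto simp: D_def)
    have "mbounded M"
      using comp unfolding compact_space_def topspace_mtopology by (rule compactin_imp_mbounded)
    then obtain B where B: "\<And>x y. x \<in> M \<Longrightarrow> y \<in> M \<Longrightarrow> d x y \<le> B"
      unfolding mbounded_alt by blast
    have "\<bar>D g z\<bar> \<le> B" if gz: "g \<in> \<Phi>" "z \<in> topspace Z" for g z
    proof -
      obtain x y where z: "z = (x, y)" "x \<in> M" "y \<in> M"
        using gz(2) unfolding topZ by blast
      moreover have "g x \<in> M"
        using gz(1) \<Phi>_top z(2) unfolding topPX by auto
      ultimately show ?thesis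
        using B[of y "g x"] by (simp add: D_def)
    qed
    then show "\<exists>B. \<forall>f\<in>D ` \<Phi>. \<forall>z\<in>topspace Z. \<bar>f z\<bar> \<le> B"
      by blast
    show "\<forall>f\<in>powertop_real (topspace Z) closure_of (D ` \<Phi>). fragmented Z uniformity f"
      using closure_sub fragD unfolding P_def by blast
  qed
  then have "admissible_Rosenthal_compactum_on Z (subtopology PX E)"
    using DE homeo unfolding admissible_Rosenthal_compactum_on_def P_def by blast
  moreover have "compact_space Z" "metrizable_space Z"
    unfolding Z_def using comp metrizable_space_mtopology
    by (simp_all add: compact_space_prod_topology metrizable_space_prod_topology)
  ultimately have "admissible_Rosenthal_compactum (subtopology PX E)"
    using compE HausE by (intro admissible_Rosenthal_compactumI)
  then show ?thesis
    unfolding E_def .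
qed

lemma G_space_translations:
  assumes "topological_group G T" "G_space G T X \<phi>" "g \<in> carrier G"
  shows "\<phi> g \<in> extensional (topspace X)" "continuous_map X X (\<phi> g)"
proof -
  have "\<phi> g \<in> Bij (topspace X)"
    using assms(2,3) group_action.bij_prop0 unfolding G_space_def by fast
  then show "\<phi> g \<in> extensional (topspace X)"
    unfolding Bij_def by blast
  have "continuous_map X (prod_topology T X) (\<lambda>x. (g, x))"
    using assms(1,3) by (simp add: continuous_map_pairedI topological_group_def)
  then have "continuous_map X X ((\<lambda>(g, x). \<phi> g x) \<circ> (\<lambda>x. (g, x)))"
    using assms(2) continuous_map_compose unfolding G_space_def by blast
  then show "continuous_map X X (\<phi> g)"
    by (simp add: comp_def)
qed

theorem proposition6p15:
  fixes G :: "('g, 'm) monoid_scheme" and T :: "'g topology"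
    and X :: "'a topology" and \<phi> :: "'g \<Rightarrow> 'a \<Rightarrow> 'a"
  assumes "topological_group G T"
    and "compact_space X" and "metrizable_space X"
    and "G_space G T X \<phi>"
  shows "(tame G X \<phi> \<longleftrightarrow> admissible_Rosenthal_compactum (enveloping_space G X \<phi>)) \<and>
         (admissible_Rosenthal_compactum (enveloping_space G X \<phi>) \<longleftrightarrow>
          Rosenthal_compactum (enveloping_space G X \<phi>))"
proof -
  obtain M d where "Metric_space M d" and X: "X = Metric_space.mtopology M d"
    using assms(3) unfolding metrizable_space_def by blast
  then interpret Metric_space M d by simp
  have comp: "compact_space mtopology"
    using assms(2) X by simp
  have \<Phi>: "g \<in> extensional M \<and> continuous_map mtopology mtopology g" if "g \<in> \<phi> ` carrier G" for g
    using that G_space_translations[OF assms(1,4)] unfolding X by auto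
  have "admissible_Rosenthal_compactum (enveloping_space G X \<phi>)" if "tame G X \<phi>"
    using closure_admissible_if_fragmented[OF comp \<Phi>] that
    unfolding tame_def enveloping_space_def enveloping_semigroup_def X by simp
  moreover have "Rosenthal_compactum (enveloping_space G X \<phi>)"
    if "admissible_Rosenthal_compactum (enveloping_space G X \<phi>)"
    using that by (rule admissible_imp_Rosenthal_compactum)
  moreover have "tame G X \<phi>" if "Rosenthal_compactum (enveloping_space G X \<phi>)"
    unfolding tame_def
  proof (rule ballI, rule ccontr)
    fix p assume p: "p \<in> enveloping_semigroup G X \<phi>" "\<not> fragmented X (compact_uniformity X) p"
    then obtain r :: "('a \<Rightarrow> 'a) \<Rightarrow> nat set set" where "r ` enveloping_semigroup G X \<phi> = UNIV"
      using not_fragmented_imp_large_closure[where \<Phi> = "\<phi> ` carrier G" and p = p, OF comp \<Phi>]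
      unfolding enveloping_semigroup_def X topspace_mtopology by blast
    moreover obtain c :: "('a \<Rightarrow> 'a) \<Rightarrow> nat set" where "inj_on c (topspace (enveloping_space G X \<phi>))"
      using Rosenthal_compactum_inj_nat_set[OF \<open>Rosenthal_compactum _\<close>] by blast
    moreover have "topspace (enveloping_space G X \<phi>) = enveloping_semigroup G X \<phi>"
      unfolding enveloping_space_def enveloping_semigroup_def topspace_subtopology
      by (intro Int_absorb1 closure_of_subset_topspace)
    ultimately show False
      using no_surj_nat_set_set by metis
  qed
  ultimately show ?thesis by blast
qed

end
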